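(* Let $\{P_0,\dots,P_m\}$ be a symmetric Clifford system on $\mathbb{R}^{2l}$ with $m>0$ and $l-m-1>0$, and let $M_i$, $N_i$, $\mathcal{U}_{\pm1}$, $\mathcal{V}_{\pm1}$ be as defined in the context. (1) For $0\le i\le m-1$, both of the focal maps $\phi_{\pm\frac{\pi}{4}}:M_{i+1}\to\mathcal{U}_{\pm1}\cong S^{l-1}(1)$ defined by $$\phi_{\pm\frac{\pi}{4}}(x)=\frac{1}{\sqrt2}(x\pm P_{i+1}x),\qquad x\in M_{i+1},$$ are submersive eigenmaps with the same eigenvalue $2l-i-3$. (2) For $2\le i\le m$, both of the focal maps $\psi_{\pm\frac{\pi}{4}}:N_{i-1}\to\mathcal{V}_{\pm1}\cong S^{l-1}(1)$ defined by $$\psi_{\pm\frac{\pi}{4}}(x)=\frac{1}{\sqrt2}(x\pm P_{i}x),\qquad x\in N_{i-1},$$ are submersive eigenmaps with the same eigenvalue $l+i-2$.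
   Context: A symmetric Clifford system on $\mathbb{R}^{2l}$ is a family $\{P_0,\dots,P_m\}$ of symmetric real $2l\times 2l$ matrices satisfying $P_\alpha P_\beta+P_\beta P_\alpha=2\delta_{\alpha\beta}I_{2l}$. $\langle\cdot,\cdot\rangle$ is the Euclidean inner product and $S^n(1)$ the unit $n$-sphere. Define $$M_i=\{x\in S^{2l-1}(1)\mid \langle P_0x,x\rangle=\cdots=\langle P_ix,x\rangle=0\}\quad(0\le i\le m),$$ $$N_i=\{x\in S^{2l-1}(1)\mid \langle P_0x,x\rangle^2+\cdots+\langle P_ix,x\rangle^2=1\}\quad(1\le i\le m),$$ smooth submanifolds of $S^{2l-1}(1)$ with the induced Riemannian metric. For $0\le i\le m-1$ let $f_i:M_i\to\mathbb{R}$, $f_i(x)=\langle P_{i+1}x,x\rangle$, and $\mathcal{U}_{\pm1}=f_i^{-1}(\pm1)$; for $2\le i\le m$ let $g_i:N_i\to\mathbb{R}$, $g_i(x)=\langle P_ix,x\rangle$, and $\mathcal{V}_{\pm1}=g_i^{-1}(\pm1)$. The set $\mathcal{U}_{\pm1}$ (resp. $\mathcal{V}_{\pm1}$) is the unit sphere of the $l$-dimensional $\pm1$-eigenspace $E_\pm(P_{i+1})\cong\mathbb{R}^l$ (resp. $E_\pm(P_i)\cong\mathbb{R}^l$), and this gives the identification with $S^{l-1}(1)\subset\mathbb{R}^l$. For a closed Riemannian manifold $M$, a map $\varphi:M\to S^n(1)\subset\mathbb{R}^{n+1}$ is an eigenmap with eigenvalue $\lambda$ if each of its $\mathbb{R}^{n+1}$-components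 $u$ is an eigenfunction of the Laplacian of $M$ with the same eigenvalue $\lambda$, i.e. $\triangle u=-\lambda u$ where $\triangle$ is the trace of the Hessian. "Submersive" means that the map is a smooth submersion. *)

theory Defs
  imports "HOL-Analysis.Analysis"
begin

text \<open>
  Submanifolds are embedded in a Euclidean space, carry the induced metric, and are represented by
  their underlying sets. Values of maps outside the submanifold are irrelevant.
\<close>

subsection \<open>Smooth maps and submanifolds\<close>

text \<open>The following two predicates are meant for open \<open>S\<close>.\<close>

primrec Ck_on :: "nat \<Rightarrow> 'a::euclidean_space set \<Rightarrow> ('a \<Rightarrow> 'b::euclidean_space) \<Rightarrow> bool" where
  "Ck_on 0 S f \<longleftrightarrow> continuous_on S f"
| "Ck_on (Suc k) S f \<longleftrightarrow> (\<forall>x\<in>S. f differentiable (at x)) \<and>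
     (\<forall>v. Ck_on k S (\<lambda>x. frechet_derivative f (at x) v))"

definition smooth_on :: "'a::euclidean_space set \<Rightarrow> ('a \<Rightarrow> 'b::euclidean_space) \<Rightarrow> bool" where
  "smooth_on S f \<longleftrightarrow> (\<forall>k. Ck_on k S f)"

text \<open>
  A \<open>d\<close>-dimensional submanifold is locally the zero set of a submersion into a vector space \<open>W\<close> of
  dimension \<open>DIM('a) - d\<close>; taking \<open>W\<close> inside \<open>'a\<close> avoids quantifying over types.
\<close>

definition smooth_submanifold :: "nat \<Rightarrow> 'a::euclidean_space set \<Rightarrow> bool" where
  "smooth_submanifold d M \<longleftrightarrow>
     (\<forall>p\<in>M. \<exists>U W (F :: 'a \<Rightarrow> 'a). open U \<and> p \<in> U \<and> subspace W \<and> dim W + d = DIM('a) \<and>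
        smooth_on U F \<and> F ` U \<subseteq> W \<and> M \<inter> U = {x\<in>U. F x = 0} \<and>
        (\<forall>x\<in>U. range (frechet_derivative F (at x)) = W))"

text \<open>Closed in the sense of compact without boundary.\<close>

definition closed_submanifold :: "'a::euclidean_space set \<Rightarrow> bool" where
  "closed_submanifold M \<longleftrightarrow> compact M \<and> M \<noteq> {} \<and> (\<exists>d. smooth_submanifold d M)"

definition smooth_map :: "'a::euclidean_space set \<Rightarrow> ('a \<Rightarrow> 'b::euclidean_space) \<Rightarrow> bool" where
  "smooth_map M f \<longleftrightarrow>
     (\<forall>p\<in>M. \<exists>U F. open U \<and> p \<in> U \<and> smooth_on U F \<and> (\<forall>x\<in>M \<inter> U. F x = f x))"

definition tangent_space :: "'a::euclidean_space set \<Rightarrow> 'a \<Rightarrow> 'a set" where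
  "tangent_space M p =
     {v. \<exists>e>0. \<exists>c :: real \<Rightarrow> 'a. smooth_on {-e<..<e} c \<and> c ` {-e<..<e} \<subseteq> M \<and> c 0 = p \<and>
           (c has_vector_derivative v) (at 0)}"

text \<open>
  The differential of \<open>f\<close> at \<open>p\<close> is \<open>frechet_derivative f (at p within M)\<close>. Derivatives within \<open>M\<close>
  are not unique as linear maps on the ambient space, but their restriction to
  \<open>tangent_space M p\<close> is, and only this restriction is used below.
\<close>

definition smooth_submersion ::
    "'a::euclidean_space set \<Rightarrow> 'b::euclidean_space set \<Rightarrow> ('a \<Rightarrow> 'b) \<Rightarrow> bool" where
  "smooth_submersion M N f \<longleftrightarrow>
     (\<exists>d. smooth_submanifold d M) \<and> (\<exists>d. smooth_submanifold d N) \<and>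
     smooth_map M f \<and> f ` M \<subseteq> N \<and>
     (\<forall>p\<in>M. frechet_derivative f (at p within M) ` tangent_space M p = tangent_space N (f p))"

subsection \<open>The Laplacian of the induced metric\<close>

definition gradient :: "'a::euclidean_space set \<Rightarrow> ('a \<Rightarrow> real) \<Rightarrow> 'a \<Rightarrow> 'a" where
  "gradient M u p =
     (THE g. g \<in> tangent_space M p \<and>
        (\<forall>v\<in>tangent_space M p. g \<bullet> v = frechet_derivative u (at p within M) v))"

definition orthogonal_projection :: "'a::euclidean_space set \<Rightarrow> 'a \<Rightarrow> 'a" where
  "orthogonal_projection V x = (THE y. y \<in> V \<and> (\<forall>w\<in>V. (x - y) \<bullet> w = 0))"

text \<open>
  The Levi-Civita connection of the induced metric is the tangential part of the Euclidean
  derivative; \<open>X\<close> is a tangent vector field on \<open>M\<close> and \<open>v\<close> a tangent vector at \<open>p\<close>.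
\<close>

definition covariant_derivative ::
    "'a::euclidean_space set \<Rightarrow> ('a \<Rightarrow> 'a) \<Rightarrow> 'a \<Rightarrow> 'a \<Rightarrow> 'a" where
  "covariant_derivative M X p v =
     orthogonal_projection (tangent_space M p) (frechet_derivative X (at p within M) v)"

definition hessian :: "'a::euclidean_space set \<Rightarrow> ('a \<Rightarrow> real) \<Rightarrow> 'a \<Rightarrow> 'a \<Rightarrow> 'a \<Rightarrow> real" where
  "hessian M u p v w = covariant_derivative M (gradient M u) p v \<bullet> w"

definition orthonormal_basis :: "'a::euclidean_space set \<Rightarrow> 'a set \<Rightarrow> bool" where
  "orthonormal_basis V B \<longleftrightarrow> pairwise orthogonal B \<and> (\<forall>b\<in>B. norm b = 1) \<and> span B = V"

definition laplacian :: "'a::euclidean_space set \<Rightarrow> ('a \<Rightarrow> real) \<Rightarrow> 'a \<Rightarrow> real" where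
  "laplacian M u p =
     (\<Sum>b\<in>(SOME B. orthonormal_basis (tangent_space M p) B). hessian M u p b b)"

definition eigenfunction :: "'a::euclidean_space set \<Rightarrow> real \<Rightarrow> ('a \<Rightarrow> real) \<Rightarrow> bool" where
  "eigenfunction M lam u \<longleftrightarrow>
     smooth_map M u \<and> (\<exists>p\<in>M. u p \<noteq> 0) \<and> (\<forall>p\<in>M. laplacian M u p = - lam * u p)"

definition eigenmap ::
    "'a::euclidean_space set \<Rightarrow> real \<Rightarrow> ('a \<Rightarrow> 'b::euclidean_space) \<Rightarrow> bool" where
  "eigenmap M lam f \<longleftrightarrow>
     closed_submanifold M \<and> f ` M \<subseteq> sphere 0 1 \<and>
     (\<forall>b\<in>Basis. eigenfunction M lam (\<lambda>x. f x \<bullet> b))"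

subsection \<open>Symmetric Clifford systems and their focal maps\<close>

definition symmetric_clifford_system :: "nat \<Rightarrow> (nat \<Rightarrow> real^'n^'n) \<Rightarrow> bool" where
  "symmetric_clifford_system m P \<longleftrightarrow>
     (\<forall>a\<le>m. transpose (P a) = P a) \<and>
     (\<forall>a\<le>m. \<forall>b\<le>m. P a ** P b + P b ** P a = (if a = b then 2 else 0) *\<^sub>R mat 1)"

definition clifford_M :: "(nat \<Rightarrow> real^'n^'n) \<Rightarrow> nat \<Rightarrow> (real^'n) set" where
  "clifford_M P i = {x \<in> sphere 0 1. \<forall>a\<le>i. (P a *v x) \<bullet> x = 0}"

definition clifford_N :: "(nat \<Rightarrow> real^'n^'n) \<Rightarrow> nat \<Rightarrow> (real^'n) set" where
  "clifford_N P i = {x \<in> sphere 0 1. (\<Sum>a\<le>i. ((P a *v x) \<bullet> x)\<^sup>2) = 1}"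

definition clifford_f :: "(nat \<Rightarrow> real^'n^'n) \<Rightarrow> nat \<Rightarrow> real^'n \<Rightarrow> real" where
  "clifford_f P i x = (P (i + 1) *v x) \<bullet> x"

definition clifford_g :: "(nat \<Rightarrow> real^'n^'n) \<Rightarrow> nat \<Rightarrow> real^'n \<Rightarrow> real" where
  "clifford_g P i x = (P i *v x) \<bullet> x"

definition clifford_U :: "(nat \<Rightarrow> real^'n^'n) \<Rightarrow> nat \<Rightarrow> real \<Rightarrow> (real^'n) set" where
  "clifford_U P i s = {x \<in> clifford_M P i. clifford_f P i x = s}"

definition clifford_V :: "(nat \<Rightarrow> real^'n^'n) \<Rightarrow> nat \<Rightarrow> real \<Rightarrow> (real^'n) set" where
  "clifford_V P i s = {x \<in> clifford_N P i. clifford_g P i x = s}"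

definition eigenspace :: "real^'n^'n \<Rightarrow> real \<Rightarrow> (real^'n) set" where
  "eigenspace A s = {x. A *v x = s *\<^sub>R x}"

text \<open>
  An identification of a subspace \<open>E\<close> of \<open>real^'n\<close> with \<open>real^'l\<close>; the values of \<open>\<iota>\<close> off \<open>E\<close>
  are irrelevant.
\<close>

definition isometric_identification ::
    "(real^'n) set \<Rightarrow> (real^'n \<Rightarrow> real^'l) \<Rightarrow> bool" where
  "isometric_identification E \<iota> \<longleftrightarrow>
     linear \<iota> \<and> (\<forall>x\<in>E. norm (\<iota> x) = norm x) \<and> \<iota> ` E = UNIV"

text \<open>The sign \<open>s\<close> selects the focal map at angle \<open>s * pi / 4\<close>.\<close>

definition focal_map :: "real^'n^'n \<Rightarrow> real \<Rightarrow> real^'n \<Rightarrow> real^'n" where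
  "focal_map A s x = (1 / sqrt 2) *\<^sub>R (x + s *\<^sub>R (A *v x))"

end

theory Submission
  imports Defs
begin

text \<open>
  A point \<open>x\<close> of either submanifold has the orthonormal system of the \<open>P\<^sub>a x\<close>, which yields an
  explicit polynomial orthogonal projector onto the tangent space at \<open>x\<close>. Since a linear function
  \<open>x \<bullet> w\<close> has the tangential part of \<open>w\<close> as gradient, its Laplacian is the trace of the derivative
  of that projector, and the Clifford relations together with \<open>tr P\<^sub>a = 0\<close> evaluate the trace to
  minus the dimension times \<open>x \<bullet> w\<close>. The focal maps are \<open>sqrt 2\<close> times the orthogonal projections
  onto the eigenspaces, hence linear; they are submersions onto the sphere because no nonzero
  eigenvector orthogonal to \<open>x\<close> is normal to the submanifold at \<open>x\<close>.
\<close>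

subsection \<open>Calculus of smooth maps\<close>

text \<open>Tangent vectors are velocities of smooth curves, so every tangent space needs explicit
  curves inside the submanifold; the Clifford relations supply algebraic ones, and differentiating
  equations gives the reverse inclusion. The harder case is \<open>N\<close>. On the unit sphere the
  sum of squares defining it is at most 1, so \<open>N\<close> is a maximum set at which the
  differential along the sphere vanishes, and no regular-value argument applies. Instead
  \<open>x\<close> is required to be fixed by the Clifford operator with coefficients
  \<open>(P a *v x) \<bullet> x\<close>. This vector equation has the right linearisation, but it is
  overdetermined, and projecting it to a normal space could enlarge its zero set; Spin invariance
  excludes this locally. That the eigenvalue is the dimension reflects minimality in the sphere
  (Takahashi): \<open>2l - 1 - (i + 2)\<close> for the \<open>i + 2\<close> quadrics,
  \<open>l + i - 2\<close> in the second case. The assumption \<open>m > 0\<close> gives each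
  operator an anticommuting partner, which forces its trace to vanish; \<open>l - m - 1 > 0\<close>
  leaves room for preimages under the focal maps of the first kind.\<close>

lemma Ck_on_cong:
  assumes "open S" "\<And>x. x \<in> S \<Longrightarrow> f x = g x" "Ck_on k S f"
  shows "Ck_on k S g"
  using assms(2,3)
proof (induction k arbitrary: f g)
  case 0
  then show ?case by (auto cong: continuous_on_cong)
next
  case (Suc k)
  have D: "(g has_derivative frechet_derivative f (at x)) (at x)" if "x \<in> S" for x
  proof -
    have "(f has_derivative frechet_derivative f (at x)) (at x)"
      using Suc.prems(2) that frechet_derivative_works by auto
    then show ?thesis
      using has_derivative_transform_within_open[OF _ assms(1) that] Suc.prems(1) by blast
  qed
  have "frechet_derivative g (at x) = frechet_derivative f (at x)" if "x \<in> S" for x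
    using frechet_derivative_at[OF D[OF that]] by simp
  then show ?case
    using Suc.prems(2) differentiableI[OF D]
    by (auto intro: Suc.IH[of "\<lambda>x. frechet_derivative f (at x) v" for v])
qed

text \<open>\<open>Ck_on\<close> refers to the chosen \<open>frechet_derivative\<close>; here any
  explicit formula for the derivative may take its place, which drives the inductions below.\<close>

lemma Ck_on_SucI:
  assumes "open S" "\<And>x. x \<in> S \<Longrightarrow> (f has_derivative D x) (at x)"
    and "\<And>v. Ck_on k S (\<lambda>x. D x v)"
  shows "Ck_on (Suc k) S f"
proof -
  have "D x v = frechet_derivative f (at x) v" if "x \<in> S" for x v
    using frechet_derivative_at[OF assms(2)[OF that]] by simp
  then show ?thesis
    using assms(3) differentiableI[OF assms(2)] by (auto intro: Ck_on_cong[OF assms(1), of "\<lambda>x. D x v" for v])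
qed

lemma Ck_on_SucD:
  assumes "Ck_on (Suc k) S f"
  shows "\<And>x. x \<in> S \<Longrightarrow> (f has_derivative frechet_derivative f (at x)) (at x)"
    and "Ck_on k S (\<lambda>x. frechet_derivative f (at x) v)"
  using assms frechet_derivative_works by auto

lemma Ck_on_Suc_imp: "Ck_on (Suc k) S f \<Longrightarrow> Ck_on k S f"
proof (induction k arbitrary: f)
  case 0
  then show ?case
    by (simp add: differentiable_imp_continuous_on differentiable_at_imp_differentiable_on)
qed auto

lemma Ck_on_const: "open S \<Longrightarrow> Ck_on k S (\<lambda>x. c)"
proof (induction k arbitrary: c)
  case (Suc k)
  then show ?case
    by (intro Ck_on_SucI[where D = "\<lambda>x v. 0"]) auto
qed auto

lemma Ck_on_linear:
  assumes "linear f" "open S" "Ck_on k S g"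
  shows "Ck_on k S (\<lambda>x. f (g x))"
  using assms(3)
proof (induction k arbitrary: g)
  case 0
  then show ?case
    using linear_continuous_on_compose[OF _ assms(1)] by auto
next
  case (Suc k)
  note D = Ck_on_SucD[OF Suc.prems]
  have "bounded_linear f" using assms(1) by (simp add: linear_conv_bounded_linear)
  with D Suc.IH show ?case
    by (intro Ck_on_SucI[where D = "\<lambda>x v. f (frechet_derivative g (at x) v)"])
      (auto intro: bounded_linear.has_derivative assms simp del: Ck_on.simps)
qed

lemma Ck_on_add:
  assumes "open S" "Ck_on k S f" "Ck_on k S g"
  shows "Ck_on k S (\<lambda>x. f x + g x)"
  using assms(2,3)
proof (induction k arbitrary: f g)
  case (Suc k)
  note D = Ck_on_SucD[OF Suc.prems(1)] Ck_on_SucD[OF Suc.prems(2)]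
  show ?case
    by (rule Ck_on_SucI[OF assms(1) has_derivative_add[OF D(1) D(3)]])
      (auto intro!: Suc.IH D(2) D(4) simp del: Ck_on.simps)
qed (auto intro: continuous_intros)

text \<open>The product rule yields bilinear terms again, in which one factor is an undifferentiated
  \<open>f\<close> or \<open>g\<close>; lowering its order by \<open>Ck_on_Suc_imp\<close> makes the
  induction hypothesis apply.\<close>

lemma Ck_on_bilinear:
  assumes "bounded_bilinear h" "open S" "Ck_on k S f" "Ck_on k S g"
  shows "Ck_on k S (\<lambda>x. h (f x) (g x))"
  using assms(3,4)
proof (induction k arbitrary: f g)
  case 0
  then show ?case using bounded_bilinear.continuous_on[OF assms(1)] by auto
next
  case (Suc k)
  note D = Ck_on_SucD[OF Suc.prems(1)] Ck_on_SucD[OF Suc.prems(2)]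
  show ?case
    by (rule Ck_on_SucI[OF assms(2) bounded_bilinear.FDERIV[OF assms(1) D(1) D(3)]])
      (auto intro!: Suc.IH Ck_on_add assms(2) D(2) D(4) Ck_on_Suc_imp[OF Suc.prems(1)]
        Ck_on_Suc_imp[OF Suc.prems(2)] simp del: Ck_on.simps)
qed

text \<open>The derivative contains the power with exponent \<open>r - 1\<close>, hence the
  induction over all \<open>r\<close>. The exponents 1/2, -1/2 and -1 later provide square roots,
  normalisation and reciprocals.\<close>

lemma Ck_on_powr:
  fixes f :: "'a::euclidean_space \<Rightarrow> real"
  assumes "open S" "\<And>x. x \<in> S \<Longrightarrow> 0 < f x" "Ck_on k S f"
  shows "Ck_on k S (\<lambda>x. f x powr r)"
  using assms(3)
proof (induction k arbitrary: r)
  case 0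
  then show ?case
    using assms(2) by (force intro!: continuous_on_powr continuous_intros)
next
  case (Suc k)
  note D = Ck_on_SucD[OF Suc.prems]
  have D': "((\<lambda>x. f x powr r) has_derivative
      (\<lambda>v. (r * f x powr (r - 1)) * frechet_derivative f (at x) v)) (at x)" if "x \<in> S" for x
  proof -
    have "((\<lambda>y. y powr r) has_derivative (\<lambda>v. (r * f x powr (r - 1)) * v)) (at (f x))"
      using has_real_derivative_powr[of "f x" r] assms(2)[OF that] by (simp add: has_field_derivative_def)
    from has_derivative_compose[OF D(1)[OF that] this] show ?thesis by simp
  qed
  show ?case
    by (rule Ck_on_SucI[OF assms(1) D'])
      (auto intro!: Ck_on_bilinear[OF bounded_bilinear_mult] Ck_on_const Suc.IH assms(1) D(2)
        Ck_on_Suc_imp[OF Suc.prems] simp del: Ck_on.simps)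
qed

lemma Ck_on_ident: "open S \<Longrightarrow> Ck_on k S (\<lambda>x. x)"
proof (induction k)
  case (Suc k)
  then show ?case
    by (intro Ck_on_SucI[where D = "\<lambda>x v. v"]) (auto intro: Ck_on_const)
qed auto

named_theorems smooth_intros

lemma smooth_on_const [smooth_intros]: "open S \<Longrightarrow> smooth_on S (\<lambda>x. c)"
  by (simp add: smooth_on_def Ck_on_const)

lemma smooth_on_ident [smooth_intros]: "open S \<Longrightarrow> smooth_on S (\<lambda>x. x)"
  by (simp add: smooth_on_def Ck_on_ident)

lemma smooth_on_compose_linear: "linear f \<Longrightarrow> open S \<Longrightarrow> smooth_on S g \<Longrightarrow> smooth_on S (\<lambda>x. f (g x))"
  by (simp add: smooth_on_def Ck_on_linear)

lemma smooth_on_linear: "linear f \<Longrightarrow> open S \<Longrightarrow> smooth_on S f"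
  using smooth_on_compose_linear[OF _ _ smooth_on_ident] by blast

lemma smooth_on_add [smooth_intros]:
  "open S \<Longrightarrow> smooth_on S f \<Longrightarrow> smooth_on S g \<Longrightarrow> smooth_on S (\<lambda>x. f x + g x)"
  by (simp add: smooth_on_def Ck_on_add)

lemma smooth_on_bilinear:
  "bounded_bilinear h \<Longrightarrow> open S \<Longrightarrow> smooth_on S f \<Longrightarrow> smooth_on S g \<Longrightarrow> smooth_on S (\<lambda>x. h (f x) (g x))"
  by (simp add: smooth_on_def Ck_on_bilinear)

lemmas smooth_on_scaleR [smooth_intros] = smooth_on_bilinear[OF bounded_bilinear_scaleR]
lemmas smooth_on_mult [smooth_intros] =
  smooth_on_bilinear[OF bounded_bilinear_mult[where 'a = real]]
lemmas smooth_on_inner [smooth_intros] = smooth_on_bilinear[OF bounded_bilinear_inner]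

lemma smooth_on_minus [smooth_intros]:
  assumes "open S" "smooth_on S f"
  shows "smooth_on S (\<lambda>x. - f x)"
  using smooth_on_compose_linear[OF _ assms, of uminus] by (simp add: linear_iff)

lemma smooth_on_diff [smooth_intros]:
  assumes "open S" "smooth_on S f" "smooth_on S g"
  shows "smooth_on S (\<lambda>x. f x - g x)"
  using smooth_on_add[OF assms(1,2) smooth_on_minus[OF assms(1,3)]] by simp

lemma smooth_on_power [smooth_intros]:
  fixes f :: "'a::euclidean_space \<Rightarrow> real"
  assumes "open S" "smooth_on S f"
  shows "smooth_on S (\<lambda>x. f x ^ n)"
  by (induction n) (auto intro: smooth_intros assms)

lemma smooth_on_sum [smooth_intros]:
  assumes "open S" "\<And>i. i \<in> I \<Longrightarrow> smooth_on S (f i)"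
  shows "smooth_on S (\<lambda>x. \<Sum>i\<in>I. f i x)"
  using assms(2) by (induction I rule: infinite_finite_induct) (auto intro: smooth_intros assms(1))

lemma smooth_on_powr:
  fixes f :: "'a::euclidean_space \<Rightarrow> real"
  shows "open S \<Longrightarrow> (\<And>x. x \<in> S \<Longrightarrow> 0 < f x) \<Longrightarrow> smooth_on S f \<Longrightarrow> smooth_on S (\<lambda>x. f x powr r)"
  by (simp add: smooth_on_def Ck_on_powr)

lemma smooth_on_subset: "smooth_on S f \<Longrightarrow> T \<subseteq> S \<Longrightarrow> smooth_on T f"
proof -
  have "Ck_on k S f \<Longrightarrow> T \<subseteq> S \<Longrightarrow> Ck_on k T f" for k
    by (induction k arbitrary: f) (auto intro: continuous_on_subset)
  then show "smooth_on S f \<Longrightarrow> T \<subseteq> S \<Longrightarrow> smooth_on T f"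
    by (auto simp: smooth_on_def)
qed

lemma smooth_on_has_derivative:
  "smooth_on S f \<Longrightarrow> x \<in> S \<Longrightarrow> (f has_derivative frechet_derivative f (at x)) (at x)"
  unfolding smooth_on_def using Ck_on_SucD(1) by blast

lemma smooth_on_continuous_derivative:
  "smooth_on S f \<Longrightarrow> continuous_on S (\<lambda>x. frechet_derivative f (at x) v)"
  unfolding smooth_on_def using Ck_on.simps(1) Ck_on_SucD(2) by blast

subsection \<open>Tangent vectors\<close>

text \<open>Chain rule: along a curve in \<open>M\<close> with velocity \<open>v\<close>, both
  \<open>D v\<close> and \<open>D' v\<close> are the velocity of the image curve.\<close>

lemma has_derivative_unique_on_tangent_space:
  assumes "(f has_derivative D) (at p within M)" "(f has_derivative D') (at p within M)"
    and "v \<in> tangent_space M p"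
  shows "D v = D' v"
proof -
  obtain e c where e: "e > 0" "c ` {-e<..<e} \<subseteq> M"
    "c 0 = p" and c: "(c has_vector_derivative v) (at 0)"
    using assms(3) unfolding tangent_space_def by auto
  have *: "((f \<circ> c) has_vector_derivative L v) (at 0)" if "(f has_derivative L) (at p within M)" for L
  proof -
    have "(c has_derivative (\<lambda>h. h *\<^sub>R v)) (at 0 within {-e<..<e})"
      using c by (simp add: has_vector_derivative_def has_derivative_at_withinI)
    moreover have "(f has_derivative L) (at (c 0) within c ` {-e<..<e})"
      using that e has_derivative_subset by metis
    ultimately have "((f \<circ> c) has_derivative (L \<circ> (\<lambda>h. h *\<^sub>R v))) (at 0 within {-e<..<e})"
      by (rule diff_chain_within)
    moreover have "L \<circ> (\<lambda>h. h *\<^sub>R v) = (\<lambda>h. h *\<^sub>R L v)"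
      using linear_scale[OF has_derivative_linear[OF that]] by auto
    ultimately show ?thesis
      using e(1) at_within_open[of 0 "{-e<..<e}"] by (simp add: has_vector_derivative_def o_def)
  qed
  show ?thesis
    using vector_derivative_unique_at[OF *[OF assms(1)] *[OF assms(2)]] .
qed

text \<open>Derivatives within \<open>M\<close> are a choice; on tangent vectors they can be
  computed from any differentiable extension to the ambient space.\<close>

lemma frechet_derivative_on_tangent_space:
  assumes "(G has_derivative L) (at p)" "\<And>x. x \<in> M \<Longrightarrow> f x = G x" "p \<in> M"
    and "v \<in> tangent_space M p"
  shows "frechet_derivative f (at p within M) v = L v"
proof -
  have "(f has_derivative L) (at p within M)"
    using has_derivative_transform[of p M f G L] assms(2,3) has_derivative_at_withinI[OF assms(1)]
    by blast
  then show ?thesis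
    using has_derivative_unique_on_tangent_space[OF _ _ assms(4)] frechet_derivative_works
      differentiableI by blast
qed

text \<open>On \<open>M\<close> the map \<open>G\<close> agrees with the zero map, so both have the
  same derivative on tangent vectors. This bounds tangent spaces from above.\<close>

lemma tangent_space_annihilates:
  fixes G :: "'a::euclidean_space \<Rightarrow> 'b::euclidean_space"
  assumes "(G has_derivative L) (at p)" "\<And>x. x \<in> M \<Longrightarrow> G x = 0" "p \<in> M"
    and "v \<in> tangent_space M p"
  shows "L v = 0"
proof -
  have "frechet_derivative (\<lambda>x. 0::'b) (at p within M) v = L v"
    by (rule frechet_derivative_on_tangent_space[OF assms(1)]) (use assms in auto)
  moreover have "frechet_derivative (\<lambda>x. 0::'b) (at p within M) v = 0"
    by (rule frechet_derivative_on_tangent_space[OF has_derivative_const]) (use assms in auto)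
  ultimately show ?thesis by simp
qed

lemma tangent_space_linear_image:
  assumes "linear g" "g ` M \<subseteq> N" "v \<in> tangent_space M p"
  shows "g v \<in> tangent_space N (g p)"
proof -
  obtain e c where e: "e > 0" "c ` {-e<..<e} \<subseteq> M" "c 0 = p" "smooth_on {-e<..<e} c"
    and c: "(c has_vector_derivative v) (at 0)"
    using assms(3) unfolding tangent_space_def by auto
  have "bounded_linear g" using assms(1) by (simp add: linear_conv_bounded_linear)
  then have "((\<lambda>t. g (c t)) has_vector_derivative g v) (at 0)"
    using bounded_linear.has_vector_derivative[OF _ c] by blast
  then show ?thesis
    using e assms smooth_on_compose_linear[OF assms(1) _ e(4)] unfolding tangent_space_def
    by (intro CollectI exI[of _ e] conjI exI[of _ "\<lambda>t. g (c t)"]) auto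
qed

text \<open>Bounds tangent spaces from below. Normalising a curve to the unit sphere keeps its
  velocity \<open>v\<close> at \<open>p\<close>, because \<open>p \<bullet> v = 0\<close> makes the
  squared norm stationary at 0; terms of second order do not matter.\<close>

lemma tangent_spaceI:
  fixes p v :: "'a::euclidean_space" and y :: "real \<Rightarrow> 'a"
  assumes p: "norm p = 1" "p \<bullet> v = 0" and y: "smooth_on UNIV y"
    and ne: "\<And>t. p + t *\<^sub>R v + t\<^sup>2 *\<^sub>R y t \<noteq> 0"
    and M: "\<And>t. sgn (p + t *\<^sub>R v + t\<^sup>2 *\<^sub>R y t) \<in> M"
  shows "v \<in> tangent_space M p"
proof -
  define g where "g t = p + t *\<^sub>R v + t\<^sup>2 *\<^sub>R y t" for t
  \<comment> \<open>This is \<open>sgn (g t)\<close>, written so that smoothness follows from the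
    closure rules.\<close>
  define c where "c t = ((g t \<bullet> g t) powr (-1/2)) *\<^sub>R g t" for t
  have pos: "g t \<bullet> g t > 0" for t using ne g_def by simp
  have sg: "smooth_on UNIV g" unfolding g_def using y by (intro smooth_intros) auto
  have sc: "smooth_on UNIV c" unfolding c_def using sg pos
    by (intro smooth_intros smooth_on_powr) auto
  have csgn: "c t = sgn (g t)" for t
    unfolding c_def sgn_div_norm norm_eq_sqrt_inner
    using pos[of t] by (simp add: powr_minus powr_half_sqrt)
  have g0: "g 0 = p" by (simp add: g_def)
  have dy: "(y has_derivative frechet_derivative y (at 0)) (at 0)"
    using smooth_on_has_derivative[OF y] by auto
  have dg: "(g has_derivative (\<lambda>h. h *\<^sub>R v)) (at 0)"
    unfolding g_def by (rule derivative_eq_intros dy refl | simp)+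
  have "((\<lambda>t. g t \<bullet> g t) has_derivative (\<lambda>h. 0)) (at 0)"
    using has_derivative_inner[OF dg dg] p g0 by (simp add: inner_commute)
  then have dn: "((\<lambda>t. g t \<bullet> g t) has_real_derivative 0) (at 0)"
    by (simp add: has_field_derivative_def lambda_zero)
  have "((\<lambda>t. (g t \<bullet> g t) powr (-1/2)) has_real_derivative 0) (at 0)"
    using DERIV_chain2[OF has_real_derivative_powr[OF pos[of 0]] dn] by simp
  then have "((\<lambda>t. (g t \<bullet> g t) powr (-1/2)) has_derivative (\<lambda>h. 0)) (at 0)"
    by (simp add: has_field_derivative_def lambda_zero)
  from has_derivative_scaleR[OF this dg] have "(c has_derivative (\<lambda>h. h *\<^sub>R v)) (at 0)"
    unfolding c_def using p g0 by (simp add: norm_eq_1)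
  then have "(c has_vector_derivative v) (at 0)" by (simp add: has_vector_derivative_def)
  moreover have "c 0 = p" using csgn g0 p by (simp add: sgn_div_norm)
  moreover have "c ` {-1<..<1} \<subseteq> M" using csgn M g_def by auto
  moreover have "smooth_on {-1<..<1} c" using sc smooth_on_subset by blast
  ultimately show ?thesis
    unfolding tangent_space_def by (intro CollectI exI[of _ 1] conjI exI[of _ c]) auto
qed

subsection \<open>Traces and orthogonal projectors\<close>

definition trace_of :: "('a::euclidean_space \<Rightarrow> 'a) \<Rightarrow> real" where
  "trace_of f = (\<Sum>b\<in>Basis. f b \<bullet> b)"

lemma trace_of_add: "trace_of (\<lambda>x. f x + g x) = trace_of f + trace_of g"
  by (simp add: trace_of_def inner_add_left sum.distrib)

lemma trace_of_diff: "trace_of (\<lambda>x. f x - g x) = trace_of f - trace_of g"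
  by (simp add: trace_of_def inner_diff_left sum_subtractf)

lemma trace_of_scaleR: "trace_of (\<lambda>x. c *\<^sub>R f x) = c * trace_of f"
  by (simp add: trace_of_def sum_distrib_left)

lemma trace_of_sum: "trace_of (\<lambda>x. \<Sum>i\<in>I. f i x) = (\<Sum>i\<in>I. trace_of (f i))"
  unfolding trace_of_def inner_sum_left by (rule sum.swap)

lemma trace_of_ident: "trace_of (\<lambda>x::'a::euclidean_space. x) = real DIM('a)"
  by (simp add: trace_of_def inner_Basis)

lemma trace_of_rank1: "trace_of (\<lambda>x. (a \<bullet> x) *\<^sub>R b) = a \<bullet> b"
  unfolding trace_of_def by (subst euclidean_inner) simp

lemma trace_of_rank1': "trace_of (\<lambda>x. (x \<bullet> a) *\<^sub>R b) = a \<bullet> b"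
  using trace_of_rank1[of a b] by (simp add: inner_commute)

lemma trace_of_minus: "trace_of (\<lambda>x. - f x) = - trace_of f"
  by (simp add: trace_of_def sum_negf)

lemmas trace_of_simps =
  trace_of_minus trace_of_add trace_of_diff trace_of_scaleR trace_of_sum trace_of_ident trace_of_rank1 trace_of_rank1'

section \<open>Orthogonal projectors and the Laplacian of linear functions\<close>

definition orthogonal_projector :: "('a::euclidean_space \<Rightarrow> 'a) \<Rightarrow> bool" where
  "orthogonal_projector \<pi> \<longleftrightarrow>
     linear \<pi> \<and> (\<forall>x y. \<pi> x \<bullet> y = x \<bullet> \<pi> y) \<and> (\<forall>x. \<pi> (\<pi> x) = \<pi> x)"

context
  fixes \<pi> :: "'a::euclidean_space \<Rightarrow> 'a"
  assumes \<pi>: "orthogonal_projector \<pi>"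
begin

lemma projector_linear: "linear \<pi>"
  and projector_sym: "\<pi> x \<bullet> y = x \<bullet> \<pi> y"
  and projector_idem: "\<pi> (\<pi> x) = \<pi> x"
  using \<pi> by (auto simp: orthogonal_projector_def)

lemma range_projector: "range \<pi> = {v. \<pi> v = v}"
  using projector_idem by (metis (mono_tags, lifting) mem_Collect_eq rangeE rangeI set_eqI)

lemma orthogonal_projection_eq: "orthogonal_projection (range \<pi>) x = \<pi> x"
  unfolding orthogonal_projection_def
proof (rule the_equality)
  show "\<pi> x \<in> range \<pi> \<and> (\<forall>w\<in>range \<pi>. (x - \<pi> x) \<bullet> w = 0)"
    by (auto simp: inner_diff_left projector_sym projector_idem)
  fix y assume y: "y \<in> range \<pi> \<and> (\<forall>w\<in>range \<pi>. (x - y) \<bullet> w = 0)"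
  then have py: "\<pi> y = y" using range_projector by auto
  have "\<pi> x - y \<in> range \<pi>"
    using py linear_diff[OF projector_linear, of x y] by (metis rangeI)
  then have "(x - y) \<bullet> (\<pi> x - y) = 0" using y by blast
  moreover have "(x - y) \<bullet> (\<pi> x - y) = (\<pi> x - y) \<bullet> (\<pi> x - y)"
    using projector_sym[of "x - y" "\<pi> x - y"] linear_diff[OF projector_linear] py projector_idem
    by (metis)
  ultimately show "y = \<pi> x" by simp
qed

text \<open>Expanding \<open>\<pi> x\<close> in \<open>B\<close> exhibits the right-hand side as a
  sum of rank-one traces. It removes the arbitrary choice of basis from
  \<open>laplacian\<close>.\<close>

lemma sum_orthonormal_basis_range:
  assumes "orthonormal_basis (range \<pi>) B" "linear L"
  shows "(\<Sum>b\<in>B. L b \<bullet> b) = trace_of (\<lambda>x. L (\<pi> x))"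
proof -
  have B: "pairwise orthogonal B" "\<And>b. b \<in> B \<Longrightarrow> norm b = 1" "span B = range \<pi>"
    using assms(1) by (auto simp: orthonormal_basis_def)
  have "independent B"
    using pairwise_orthogonal_independent[OF B(1)] B(2) by fastforce
  then have fin: "finite B" by (rule independent_imp_finite)
  have px: "\<pi> x = (\<Sum>b\<in>B. (b \<bullet> x) *\<^sub>R b)" for x
  proof -
    have "\<pi> x \<in> span B" using B(3) by auto
    from orthonormal_basis_expand[OF B(1) B(2) this fin]
    have "\<pi> x = (\<Sum>b\<in>B. (\<pi> x \<bullet> b) *\<^sub>R b)" by simp
    also have "\<dots> = (\<Sum>b\<in>B. (b \<bullet> x) *\<^sub>R b)"
    proof (intro sum.cong refl)
      fix b assume "b \<in> B"
      then have "\<pi> b = b" using B(3) span_base range_projector by (metis (mono_tags) mem_Collect_eq)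
      then show "(\<pi> x \<bullet> b) *\<^sub>R b = (b \<bullet> x) *\<^sub>R b"
        using projector_sym[of x b] by (simp add: inner_commute)
    qed
    finally show ?thesis .
  qed
  have "L (\<pi> x) = (\<Sum>b\<in>B. (b \<bullet> x) *\<^sub>R L b)" for x
    unfolding px by (simp add: linear_sum[OF assms(2)] linear_scale[OF assms(2)])
  then show ?thesis
    by (simp add: trace_of_sum trace_of_rank1 inner_commute)
qed

text \<open>The case of the identity as \<open>L\<close>: dimensions can be read off from
  traces.\<close>

lemma dim_range_projector: "real (dim (range \<pi>)) = trace_of \<pi>"
proof -
  have sub: "subspace (range \<pi>)"
    using linear_subspace_image[OF projector_linear subspace_UNIV] by simp
  obtain B where B: "B \<subseteq> range \<pi>" "pairwise orthogonal B"
    "\<And>x. x \<in> B \<Longrightarrow> norm x = 1"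
    "independent B" "card B = dim (range \<pi>)" "span B = range \<pi>"
    using orthonormal_basis_subspace[OF sub] by metis
  then have "orthonormal_basis (range \<pi>) B" by (simp add: orthonormal_basis_def)
  from sum_orthonormal_basis_range[OF this linear_id]
  have "(\<Sum>b\<in>B. b \<bullet> b) = trace_of \<pi>" by (simp add: id_def)
  then show ?thesis using B(3,5) by (simp add: norm_eq_1)
qed

text \<open>The gradient of \<open>x \<bullet> w\<close> is the tangential part
  \<open>\<rho> x w\<close> of \<open>w\<close>, so the covariant Hessian is the tangential part of
  \<open>L\<close>; paired with a tangent vector, that outer projection disappears.\<close>

lemma laplacian_inner_eq_trace:
  assumes "tangent_space M p = range \<pi>" "p \<in> M"
    and "\<And>x. x \<in> M \<Longrightarrow> orthogonal_projector (\<rho> x)"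
    and "\<And>x. x \<in> M \<Longrightarrow> tangent_space M x = range (\<rho> x)"
    and "((\<lambda>x. \<rho> x w) has_derivative L) (at p)"
  shows "laplacian M (\<lambda>x. x \<bullet> w) p = trace_of (\<lambda>v. L (\<pi> v))"
proof -
  have grad: "gradient M (\<lambda>x. x \<bullet> w) x = \<rho> x w" if x: "x \<in> M" for x
    unfolding gradient_def
  proof (rule the_equality)
    note \<rho> = assms(3)[OF x]
    have sym: "\<rho> x a \<bullet> b = a \<bullet> \<rho> x b" and idem: "\<rho> x (\<rho> x a) = \<rho> x a" and lin: "linear (\<rho> x)" for a b
      using \<rho> by (auto simp: orthogonal_projector_def)
    have D: "frechet_derivative (\<lambda>x. x \<bullet> w) (at x within M) v = v \<bullet> w" if "v \<in> tangent_space M x" for v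
      by (rule frechet_derivative_on_tangent_space[OF _ _ x that])
        (auto intro!: derivative_eq_intros)
    show "\<rho> x w \<in> tangent_space M x \<and>
        (\<forall>v\<in>tangent_space M x. \<rho> x w \<bullet> v = frechet_derivative (\<lambda>x. x \<bullet> w) (at x within M) v)"
      using D assms(4)[OF x] sym idem by (auto simp: inner_commute)
    fix g assume g: "g \<in> tangent_space M x \<and>
        (\<forall>v\<in>tangent_space M x. g \<bullet> v = frechet_derivative (\<lambda>x. x \<bullet> w) (at x within M) v)"
    then have gg: "\<rho> x g = g" using assms(4)[OF x] idem by auto
    have "g \<bullet> v = \<rho> x w \<bullet> v" for v
    proof -
      have "g \<bullet> v = g \<bullet> \<rho> x v" using gg sym by metis
      also have "\<dots> = \<rho> x v \<bullet> w" using g D assms(4)[OF x] by auto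
      finally show ?thesis using sym by (simp add: inner_commute)
    qed
    then show "g = \<rho> x w" by (metis vector_eq_rdot)
  qed
  define B where "B = (SOME B. orthonormal_basis (tangent_space M p) B)"
  have sub: "subspace (range \<pi>)"
    using linear_subspace_image[OF projector_linear subspace_UNIV] by simp
  have "\<exists>B. orthonormal_basis (tangent_space M p) B"
    unfolding orthonormal_basis_def assms(1)
    using orthonormal_basis_subspace[OF sub] by metis
  then have B: "orthonormal_basis (range \<pi>) B"
    unfolding B_def assms(1)[symmetric] by (rule someI_ex)
  have "hessian M (\<lambda>x. x \<bullet> w) p b b = L b \<bullet> b" if "b \<in> B" for b
  proof -
    have "b \<in> range \<pi>"
      using B span_base[OF that] by (simp add: orthonormal_basis_def)
    then have b: "b \<in> tangent_space M p" "\<pi> b = b"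
      using assms(1) range_projector by auto
    have "frechet_derivative (gradient M (\<lambda>x. x \<bullet> w)) (at p within M) b = L b"
      by (rule frechet_derivative_on_tangent_space[OF assms(5) grad assms(2) b(1)])
    then show ?thesis
      unfolding hessian_def covariant_derivative_def assms(1) orthogonal_projection_eq
      using b(2) by (simp add: projector_sym)
  qed
  then have "laplacian M (\<lambda>x. x \<bullet> w) p = (\<Sum>b\<in>B. L b \<bullet> b)"
    unfolding laplacian_def B_def[symmetric] by (intro sum.cong) auto
  then show ?thesis
    using sum_orthonormal_basis_range[OF B has_derivative_linear[OF assms(5)]] by simp
qed

end

section \<open>Submanifolds from equations projected to a normal space\<close>

lemma orthogonal_projector_complement:
  assumes "orthogonal_projector \<pi>"
  shows "orthogonal_projector (\<lambda>x. x - \<pi> x)"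
proof -
  have "linear \<pi>" using assms by (simp add: orthogonal_projector_def)
  then have "linear (\<lambda>x. x - \<pi> x)"
    by (simp add: linear_compose_sub[OF linear_ident])
  then show ?thesis
    using assms linear_diff[OF \<open>linear \<pi>\<close>]
    by (auto simp: orthogonal_projector_def inner_diff_left inner_diff_right)
qed

text \<open>
  Composing with the orthogonal projector onto the normal space at \<open>p\<close> turns an equation whose
  differential has the right range only at \<open>p\<close> into a submersion near \<open>p\<close>.
\<close>

lemma smooth_submanifoldI:
  fixes M :: "'a::euclidean_space set"
  assumes "\<And>p. p \<in> M \<Longrightarrow> \<exists>U F D \<pi>. open U \<and> p \<in> U \<and> smooth_on U F \<and>
      (F has_derivative D) (at p) \<and> orthogonal_projector \<pi> \<and> trace_of \<pi> = real d \<and>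
      (\<forall>w. \<pi> (D w) = 0) \<and> (\<forall>w. \<pi> w = 0 \<longrightarrow> D w = 0 \<longrightarrow> w = 0) \<and>
      (\<forall>x\<in>U. x \<in> M \<longleftrightarrow> F x = \<pi> (F x))"
  shows "smooth_submanifold d M"
  unfolding smooth_submanifold_def
proof
  fix p assume "p \<in> M"
  then obtain U and F :: "'a \<Rightarrow> 'a" and D \<pi> where U: "open U" "p \<in> U" "smooth_on U F"
    and D: "(F has_derivative D) (at p)" and \<pi>: "orthogonal_projector \<pi>" "trace_of \<pi> = real d"
    and D\<pi>: "\<And>w. \<pi> (D w) = 0"
    "\<And>w. \<pi> w = 0 \<Longrightarrow> D w = 0 \<Longrightarrow> w = 0"
    and UM: "\<And>x. x \<in> U \<Longrightarrow> x \<in> M \<longleftrightarrow> F x = \<pi> (F x)"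
    using assms by metis
  define \<nu> where "\<nu> x = x - \<pi> x" for x
  have \<nu>: "orthogonal_projector \<nu>"
    unfolding \<nu>_def[abs_def] by (rule orthogonal_projector_complement[OF \<pi>(1)])
  note lin = projector_linear[OF \<nu>]
  define W where "W = range \<nu>"
  have W: "w \<in> W \<longleftrightarrow> \<pi> w = 0" for w
    unfolding W_def range_projector[OF \<nu>] by (simp add: \<nu>_def)
  have subW: "subspace W"
    unfolding W_def using linear_subspace_image[OF lin subspace_UNIV] .
  have "trace_of \<nu> = real DIM('a) - real d"
    unfolding \<nu>_def[abs_def] by (simp add: trace_of_simps \<pi>(2))
  then have "real (dim W) = real DIM('a) - real d"
    unfolding W_def dim_range_projector[OF \<nu>] .
  then have dimW: "dim W + d = DIM('a)" by linarith
  define G where "G x = \<nu> (F x)" for x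
  have smG: "smooth_on U G"
    unfolding G_def by (rule smooth_on_compose_linear[OF lin U(1,3)])
  have "bounded_linear \<nu>" using lin by (simp add: linear_conv_bounded_linear)
  from bounded_linear.has_derivative[OF this D]
  have "(G has_derivative D) (at p)"
    by (simp add: G_def[abs_def] \<nu>_def D\<pi>(1))
  then have Gp: "frechet_derivative G (at p) = D" by (rule frechet_derivative_at[symmetric])
  have DG: "(G has_derivative frechet_derivative G (at x)) (at x)" if "x \<in> U" for x
    using smooth_on_has_derivative[OF smG that] .
  have linD: "linear (frechet_derivative G (at x))" if "x \<in> U" for x
    using has_derivative_linear[OF DG[OF that]] .
  have rangeD: "frechet_derivative G (at x) v \<in> W" if "x \<in> U" for x v
  proof -
    have "(F has_derivative frechet_derivative F (at x)) (at x)"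
      using smooth_on_has_derivative[OF U(3) that] .
    from bounded_linear.has_derivative[OF \<open>bounded_linear \<nu>\<close> this]
    have "frechet_derivative G (at x) = (\<lambda>v. \<nu> (frechet_derivative F (at x) v))"
      unfolding G_def[abs_def] by (rule frechet_derivative_at[symmetric])
    then show ?thesis by (simp add: W_def)
  qed
  have "bounded_linear D" using D has_derivative_bounded_linear by blast
  then obtain e where e: "e > 0" "\<And>w. w \<in> W \<Longrightarrow> e * norm w \<le> norm (D w)"
    using injective_imp_isometric[OF closed_subspace[OF subW] subW] D\<pi>(2) W by metis
  \<comment> \<open>\<open>h x\<close> bounds the operator norm of the change of the derivative from
    \<open>p\<close> to \<open>x\<close>. While it is below the constant \<open>e\<close>, by which
    \<open>D\<close> is bounded below on \<open>W\<close>, the derivative at \<open>x\<close> stays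
    injective on \<open>W\<close> and hence maps onto \<open>W\<close>.\<close>
  define h where "h x = (\<Sum>b\<in>Basis. norm (frechet_derivative G (at x) b - D b))" for x
  have "continuous_on U h"
    unfolding h_def by (intro continuous_intros smooth_on_continuous_derivative[OF smG])
  then have opV: "open (U \<inter> h -` {..<e})"
    using continuous_on_open_vimage U(1) open_lessThan by (metis Int_commute)
  have range_eq: "range (frechet_derivative G (at x)) = W" if x: "x \<in> U" "h x < e" for x
  proof
    let ?A = "frechet_derivative G (at x)"
    show "range ?A \<subseteq> W" using rangeD[OF x(1)] by auto
    have "w = 0" if w: "w \<in> W" "?A w = 0" for w
    proof (rule ccontr)
      assume "w \<noteq> 0"
      have lin': "linear (\<lambda>v. ?A v - D v)"
        using linear_compose_sub[OF linD[OF x(1)] bounded_linear.linear[OF \<open>bounded_linear D\<close>]] .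
      have "e * norm w \<le> norm (?A w - D w)" using e(2)[OF w(1)] w(2) by simp
      also have "?A w - D w = (\<Sum>b\<in>Basis. (w \<bullet> b) *\<^sub>R (?A b - D b))"
        using linear_sum[OF lin', of "\<lambda>b. (w \<bullet> b) *\<^sub>R b" Basis] linear_scale[OF lin']
        by (simp add: euclidean_representation)
      also have "norm \<dots> \<le> (\<Sum>b\<in>Basis. norm w * norm (?A b - D b))"
        by (intro order_trans[OF norm_sum] sum_mono) (auto intro!: mult_right_mono Basis_le_norm)
      also have "\<dots> = norm w * h x" by (simp add: h_def sum_distrib_left)
      also have "\<dots> < norm w * e" using x(2) \<open>w \<noteq> 0\<close> by simp
      finally show False by (simp add: mult.commute)
    qed
    then have "inj_on ?A W"
      using linear_injective_on_subspace_0[OF linD[OF x(1)] subW] by blast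
    then have "inj_on ?A (span W)"
      by (simp add: span_eq_iff[THEN iffD2, OF subW])
    then have "dim (?A ` W) = dim W" by (rule dim_image_eq[OF linD[OF x(1)]])
    moreover have "?A ` W \<subseteq> W" using rangeD[OF x(1)] by auto
    ultimately have "?A ` W = W"
      using subspace_dim_equal[OF linear_subspace_image[OF linD[OF x(1)] subW] subW] by simp
    then show "W \<subseteq> range ?A" by blast
  qed
  show "\<exists>U W (F :: 'a \<Rightarrow> 'a). open U \<and> p \<in> U \<and> subspace W \<and> dim W + d = DIM('a) \<and>
        smooth_on U F \<and> F ` U \<subseteq> W \<and> M \<inter> U = {x\<in>U. F x = 0} \<and>
        (\<forall>x\<in>U. range (frechet_derivative F (at x)) = W)"
  proof (rule exI[of _ "U \<inter> h -` {..<e}"], rule exI[of _ W], rule exI[of _ G], intro conjI)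
    show "p \<in> U \<inter> h -` {..<e}" using U e(1) by (simp add: h_def Gp)
    show "smooth_on (U \<inter> h -` {..<e}) G" using smG smooth_on_subset by blast
    show "G ` (U \<inter> h -` {..<e}) \<subseteq> W" by (auto simp: G_def W_def)
    show "M \<inter> (U \<inter> h -` {..<e}) = {x \<in> U \<inter> h -` {..<e}. G x = 0}"
      using UM by (auto simp: G_def \<nu>_def)
  qed (use subW dimW opV range_eq in auto)
qed

subsection \<open>Clifford families\<close>

text \<open>The index set is arbitrary so that \<open>{..k}\<close> for every \<open>k\<close>, and
  the empty family for the plain sphere, are instances. Vanishing traces are assumed separately,
  since for a single operator they do not follow from the relations (the identity satisfies
  them).\<close>

locale clifford_family =
  fixes J :: "nat set" and P :: "nat \<Rightarrow> 'a::euclidean_space \<Rightarrow> 'a"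
  assumes finite_J: "finite J"
    and P_linear: "\<And>a. a \<in> J \<Longrightarrow> linear (P a)"
    and P_sym: "\<And>a x y. a \<in> J \<Longrightarrow> P a x \<bullet> y = x \<bullet> P a y"
    and P_anticommute: "\<And>a b x. a \<in> J \<Longrightarrow> b \<in> J \<Longrightarrow>
      P a (P b x) + P b (P a x) = (if a = b then 2 else 0) *\<^sub>R x"
    and trace_P: "\<And>a. a \<in> J \<Longrightarrow> trace_of (P a) = 0"
begin

text \<open>For coefficient vectors of length 1 these are the elements of the Clifford sphere, all
  of them symmetric involutions.\<close>

definition comb :: "(nat \<Rightarrow> real) \<Rightarrow> 'a \<Rightarrow> 'a" where
  "comb c x = (\<Sum>a\<in>J. c a *\<^sub>R P a x)"

lemma P_invol: "a \<in> J \<Longrightarrow> P a (P a x) = x"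
  using P_anticommute[of a a x] by (simp add: scaleR_2[symmetric])

lemma P_swap: "a \<in> J \<Longrightarrow> b \<in> J \<Longrightarrow> a \<noteq> b \<Longrightarrow> P a (P b x) = - P b (P a x)"
  using P_anticommute[of a b x] by (simp add: eq_neg_iff_add_eq_0)

lemma P_inner_P:
  assumes "a \<in> J" "b \<in> J"
  shows "P a x \<bullet> P b x = (if a = b then x \<bullet> x else 0)"
proof (cases "a = b")
  case False
  have "P a x \<bullet> P b x = x \<bullet> P a (P b x)" "P a x \<bullet> P b x = x \<bullet> P b (P a x)"
    using P_sym[OF assms(1), of x "P b x"] P_sym[OF assms(2), of x "P a x"]
    by (simp_all add: inner_commute)
  then show ?thesis using P_swap[OF assms False, of x] False by simp
qed (use assms P_sym P_invol in auto)

lemma linear_comb: "linear (comb c)"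
  unfolding comb_def by (intro linear_compose_sum ballI linear_compose_scale_right P_linear)

lemma comb_sym: "comb c x \<bullet> y = x \<bullet> comb c y"
  unfolding comb_def by (simp add: inner_sum_left inner_sum_right P_sym)

lemma P_comb_anticommute:
  assumes "a \<in> J"
  shows "P a (comb c x) + comb c (P a x) = (2 * c a) *\<^sub>R x"
proof -
  have "P a (comb c x) = (\<Sum>b\<in>J. c b *\<^sub>R P a (P b x))"
    unfolding comb_def by (simp add: linear_sum[OF P_linear[OF assms]] linear_scale[OF P_linear[OF assms]])
  then have "P a (comb c x) + comb c (P a x) = (\<Sum>b\<in>J. c b *\<^sub>R (P a (P b x) + P b (P a x)))"
    by (simp add: comb_def sum.distrib scaleR_add_right)
  also have "\<dots> = (\<Sum>b\<in>J. if b = a then (2 * c a) *\<^sub>R x else 0)"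
    using P_anticommute assms by (intro sum.cong) auto
  also have "\<dots> = (2 * c a) *\<^sub>R x" using assms finite_J by simp
  finally show ?thesis .
qed

lemma comb_anticommute: "comb c (comb d x) + comb d (comb c x) = (2 * (\<Sum>a\<in>J. c a * d a)) *\<^sub>R x"
proof -
  have "comb d (comb c x) = (\<Sum>a\<in>J. c a *\<^sub>R comb d (P a x))"
    by (subst (2) comb_def) (simp add: linear_sum[OF linear_comb] linear_scale[OF linear_comb])
  moreover have "comb c (comb d x) = (\<Sum>a\<in>J. c a *\<^sub>R P a (comb d x))"
    by (subst comb_def) simp
  ultimately have "comb c (comb d x) + comb d (comb c x) =
      (\<Sum>a\<in>J. c a *\<^sub>R (P a (comb d x) + comb d (P a x)))"
    by (simp add: sum.distrib scaleR_add_right)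
  also have "\<dots> = (\<Sum>a\<in>J. (2 * (c a * d a)) *\<^sub>R x)"
    by (intro sum.cong) (auto simp: P_comb_anticommute)
  finally show ?thesis by (simp add: scaleR_sum_left[symmetric] sum_distrib_left)
qed

lemma comb_comb: "comb c (comb c x) = (\<Sum>a\<in>J. (c a)\<^sup>2) *\<^sub>R x"
  using comb_anticommute[of c c x]
  by (simp add: power2_eq_square scaleR_2[symmetric] scaleR_scaleR[symmetric] del: scaleR_scaleR)

lemma comb_inner_comb: "comb c x \<bullet> comb d x = (\<Sum>a\<in>J. c a * d a) * (x \<bullet> x)"
proof -
  have "comb c x \<bullet> comb d x = x \<bullet> comb c (comb d x)"
    "comb c x \<bullet> comb d x = x \<bullet> comb d (comb c x)"
    using comb_sym[of c x "comb d x"] comb_sym[of d x "comb c x"] by (simp_all add: inner_commute)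
  then have "2 * (comb c x \<bullet> comb d x) = x \<bullet> (comb c (comb d x) + comb d (comb c x))"
    by (simp add: inner_add_right)
  then show ?thesis by (simp add: comb_anticommute)
qed

lemma P_inner_comb: "a \<in> J \<Longrightarrow> P a x \<bullet> comb c x = c a * (x \<bullet> x)"
proof -
  assume a: "a \<in> J"
  have "P a x \<bullet> comb c x = (\<Sum>b\<in>J. c b * (if a = b then x \<bullet> x else 0))"
    unfolding comb_def inner_sum_right using a by (intro sum.cong) (auto simp: P_inner_P)
  also have "\<dots> = (\<Sum>b\<in>J. if a = b then c b * (x \<bullet> x) else 0)" by (intro sum.cong) auto
  finally show ?thesis using a finite_J by simp
qed

lemma comb_inner_self: "comb c x \<bullet> y = (\<Sum>a\<in>J. c a * (P a x \<bullet> y))"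
  by (simp add: comb_def inner_sum_left)

lemma inner_comb_self: "x \<bullet> comb c x = (\<Sum>a\<in>J. c a * (P a x \<bullet> x))"
  using comb_inner_self[of c x x] by (simp add: inner_commute)

lemma smooth_on_P: "a \<in> J \<Longrightarrow> open S \<Longrightarrow> smooth_on S f \<Longrightarrow> smooth_on S (\<lambda>x. P a (f x))"
  by (rule smooth_on_compose_linear[OF P_linear])

lemma has_derivative_P: "a \<in> J \<Longrightarrow> (P a has_derivative P a) F"
  using P_linear linear_conv_bounded_linear by (blast intro: bounded_linear_imp_has_derivative)

lemma has_derivative_q:
  assumes "a \<in> J"
  shows "((\<lambda>x. P a x \<bullet> x) has_derivative (\<lambda>v. 2 * (P a x \<bullet> v))) (at x)"
proof -
  have "((\<lambda>x. P a x \<bullet> x) has_derivative (\<lambda>v. P a x \<bullet> v + P a v \<bullet> x)) (at x)"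
    by (rule has_derivative_inner[OF has_derivative_P[OF assms] has_derivative_ident])
  then show ?thesis using P_sym[OF assms] by (simp add: inner_commute)
qed

lemma continuous_on_q: "a \<in> J \<Longrightarrow> continuous_on S (\<lambda>x. P a x \<bullet> x)"
  by (intro continuous_at_imp_continuous_on ballI has_derivative_continuous[OF has_derivative_q])

lemma P_sgn_inner: "a \<in> J \<Longrightarrow> P a (sgn x) \<bullet> sgn x = (P a x \<bullet> x) / (norm x)\<^sup>2"
  using linear_scale[OF P_linear] by (simp add: sgn_div_norm power2_eq_square divide_inverse)

subsection \<open>The intersections of quadrics\<close>

definition quadrics :: "'a set" where
  "quadrics = {x \<in> sphere 0 1. \<forall>a\<in>J. P a x \<bullet> x = 0}"

definition proj_quadrics :: "'a \<Rightarrow> 'a \<Rightarrow> 'a" where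
  "proj_quadrics x v = v - (x \<bullet> v) *\<^sub>R x - comb (\<lambda>a. P a x \<bullet> v) x"

lemma quadricsD:
  assumes "x \<in> quadrics"
  shows "x \<bullet> x = 1" "norm x = 1" "\<And>a. a \<in> J \<Longrightarrow> P a x \<bullet> x = 0"
    "\<And>a. a \<in> J \<Longrightarrow> x \<bullet> P a x = 0"
  using assms by (auto simp: quadrics_def norm_eq_1 inner_commute)

lemma compact_quadrics: "compact quadrics"
proof -
  have "quadrics = sphere 0 1 \<inter> (\<Inter>a\<in>J. {x. P a x \<bullet> x = 0})"
    by (auto simp: quadrics_def)
  moreover have "closed {x. P a x \<bullet> x = 0}" if "a \<in> J" for a
    using continuous_on_q[OF that] by (intro closed_Collect_eq continuous_on_const)
  ultimately show ?thesis
    by (auto intro!: compact_Int_closed closed_INT)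
qed

context
  fixes p assumes p: "p \<in> quadrics"
begin

lemma proj_quadrics_normal:
  "p \<bullet> proj_quadrics p v = 0" "a \<in> J \<Longrightarrow> P a p \<bullet> proj_quadrics p v = 0"
  using quadricsD[OF p]
  by (auto simp: proj_quadrics_def inner_diff_right P_inner_comb inner_comb_self)

lemma proj_quadrics_eq_iff: "proj_quadrics p v = v \<longleftrightarrow> p \<bullet> v = 0 \<and> (\<forall>a\<in>J. P a p \<bullet> v = 0)"
proof
  assume "proj_quadrics p v = v"
  then show "p \<bullet> v = 0 \<and> (\<forall>a\<in>J. P a p \<bullet> v = 0)"
    using proj_quadrics_normal by metis
qed (auto simp: proj_quadrics_def comb_def)

lemma orthogonal_projector_quadrics: "orthogonal_projector (proj_quadrics p)"
proof -
  have "linear (proj_quadrics p)"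
    unfolding proj_quadrics_def comb_def
    by (rule linearI)
      (simp_all add: inner_add_right algebra_simps sum.distrib scaleR_sum_right)
  moreover have "proj_quadrics p x \<bullet> y = x \<bullet> proj_quadrics p y" for x y
    unfolding proj_quadrics_def comb_def
    by (simp add: inner_diff_left inner_diff_right inner_sum_left inner_sum_right inner_commute mult.commute)
  moreover have "proj_quadrics p (proj_quadrics p x) = proj_quadrics p x" for x
    using proj_quadrics_eq_iff proj_quadrics_normal by blast
  ultimately show ?thesis by (simp add: orthogonal_projector_def)
qed

lemma trace_proj_quadrics: "trace_of (proj_quadrics p) = real DIM('a) - 1 - real (card J)"
  unfolding proj_quadrics_def comb_def using quadricsD[OF p]
  by (simp add: trace_of_simps P_inner_P)

text \<open>Removing the normal directions \<open>p\<close> and \<open>P b p\<close> from the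
  trace-free \<open>P a\<close> subtracts only multiples of \<open>P a p \<bullet> p\<close>, which
  is 0 on the quadrics. This kills the terms of the Laplacian in which \<open>P a\<close> acts on
  the differentiated argument.\<close>

lemma trace_P_proj_quadrics:
  assumes "a \<in> J"
  shows "trace_of (\<lambda>v. P a (proj_quadrics p v)) = 0"
proof -
  have "P a (proj_quadrics p v) =
      P a v - (p \<bullet> v) *\<^sub>R P a p - (\<Sum>b\<in>J. (P b p \<bullet> v) *\<^sub>R P a (P b p))" for v
    using P_linear[OF assms]
    by (simp add: proj_quadrics_def comb_def linear_diff linear_scale linear_sum)
  moreover have "P b p \<bullet> P a (P b p) = 0" if "b \<in> J" for b
  proof (cases "a = b")
    case True
    then show ?thesis using P_invol quadricsD[OF p] assms by simp
  next
    case False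
    then show ?thesis
      using P_swap[OF assms that] P_sym[OF that] P_invol[OF that] quadricsD[OF p] assms
      by simp
  qed
  ultimately show ?thesis
    using trace_P[OF assms] quadricsD[OF p] assms by (simp add: trace_of_simps)
qed

text \<open>
  The curve corrects \<open>u = p + t v\<close> by a multiple \<open>\<mu>\<close> of \<open>comb d u\<close>, where \<open>d a = P a u \<bullet> u\<close>. By the
  Clifford relations all the conditions \<open>P a \<gamma> \<bullet> \<gamma> = 0\<close> then reduce to the one scalar equation
  \<open>1 - 2 \<mu> (u \<bullet> u) + \<mu>\<^sup>2 (\<Sum>a. (d a)\<^sup>2) = 0\<close>, of which \<open>\<mu>\<close> is the root that is regular at \<open>t = 0\<close>.
\<close>

lemma quadrics_tangent_curve:
  assumes v: "p \<bullet> v = 0" "\<And>a. a \<in> J \<Longrightarrow> P a p \<bullet> v = 0"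
  shows "v \<in> tangent_space quadrics p"
proof -
  define \<delta> where "\<delta> a = P a v \<bullet> v" for a
  define D where "D = (\<Sum>a\<in>J. (\<delta> a)\<^sup>2)"
  define n where "n t = 1 + t\<^sup>2 * (v \<bullet> v)" for t :: real
  define r where "r t = ((n t)\<^sup>2 - t ^ 4 * D) powr (1/2)" for t
  \<comment> \<open>Here \<open>n t\<close> is \<open>u t \<bullet> u t\<close> and
    \<open>t ^ 4 * D\<close> the sum of squares in the quadratic equation. The root
    \<open>(n t - r t) / (t ^ 4 * D)\<close> is rationalised, so that it makes sense when the
    denominator vanishes.\<close>
  define \<mu> where "\<mu> t = (n t + r t) powr (-1)" for t
  define u where "u t = p + t *\<^sub>R v" for t :: real
  define \<gamma> where "\<gamma> t = u t - (t\<^sup>2 * \<mu> t) *\<^sub>R comb \<delta> (u t)" for t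
  have D0: "D \<ge> 0" by (simp add: D_def sum_nonneg)
  \<comment> \<open>Cauchy-Schwarz for \<open>comb \<delta> v\<close> and \<open>v\<close>; it keeps
    the discriminant positive for every \<open>t\<close>.\<close>
  have Dle: "D \<le> (v \<bullet> v)\<^sup>2"
  proof -
    have 1: "comb \<delta> v \<bullet> v = D" by (simp add: comb_inner_self D_def \<delta>_def power2_eq_square)
    have "D\<^sup>2 \<le> (comb \<delta> v \<bullet> comb \<delta> v) * (v \<bullet> v)"
      using Cauchy_Schwarz_ineq[of "comb \<delta> v" v] 1 by simp
    also have "\<dots> = D * (v \<bullet> v)\<^sup>2"
      by (simp add: comb_inner_comb D_def power2_eq_square)
    finally show ?thesis
      using D0 by (cases "D = 0") (auto simp: power2_eq_square)
  qed
  have n_pos: "n t > 0" for t by (simp add: n_def add_pos_nonneg)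
  have rad: "(n t)\<^sup>2 - t ^ 4 * D > 0" for t
  proof -
    have "t ^ 4 * D \<le> t ^ 4 * (v \<bullet> v)\<^sup>2" using Dle by (intro mult_left_mono) auto
    also have "\<dots> = (t\<^sup>2 * (v \<bullet> v))\<^sup>2" by (simp add: power_mult_distrib)
    also have "\<dots> < (n t)\<^sup>2" unfolding n_def by (intro power_strict_mono) auto
    finally show ?thesis by simp
  qed
  have r_pos: "r t > 0" for t using rad[of t] by (simp add: r_def)
  have r2: "(r t)\<^sup>2 = (n t)\<^sup>2 - t ^ 4 * D" for t
    using rad[of t] by (simp add: r_def powr_half_sqrt)
  have \<mu>1: "\<mu> t * (n t + r t) = 1" for t
    using n_pos[of t] r_pos[of t] by (simp add: \<mu>_def powr_minus_divide)
  have \<mu>D: "\<mu> t * t ^ 4 * D = n t - r t" for t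
  proof -
    have "t ^ 4 * D = (n t + r t) * (n t - r t)" using r2[of t] by (simp add: algebra_simps power2_eq_square)
    then have "\<mu> t * t ^ 4 * D = (\<mu> t * (n t + r t)) * (n t - r t)" by simp
    then show ?thesis using \<mu>1 by simp
  qed
  have key: "1 - 2 * \<mu> t * n t + (\<mu> t)\<^sup>2 * t ^ 4 * D = 0" for t
  proof -
    have "(\<mu> t)\<^sup>2 * t ^ 4 * D = \<mu> t * (n t - r t)"
      using \<mu>D[of t] by (simp add: power2_eq_square mult.assoc)
    then show ?thesis using \<mu>1[of t] by (simp add: algebra_simps)
  qed
  have uu: "u t \<bullet> u t = n t" for t
    using v quadricsD[OF p] by (simp add: u_def n_def inner_add_left inner_add_right inner_commute power2_eq_square)
  have Pu: "P a (u t) \<bullet> u t = t\<^sup>2 * \<delta> a" if "a \<in> J" for a t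
  proof -
    have "P a v \<bullet> p = 0" using v(2)[OF that] P_sym[OF that] by (simp add: inner_commute)
    then show ?thesis
      using v(2)[OF that] quadricsD[OF p] that P_linear[OF that]
      by (simp add: u_def \<delta>_def linear_add linear_scale inner_add_left inner_add_right power2_eq_square)
  qed
  have Cu: "comb \<delta> (u t) \<bullet> u t = t\<^sup>2 * D" for t
    by (simp add: comb_inner_self Pu D_def power2_eq_square sum_distrib_left mult_ac)
  have ne: "\<gamma> t \<noteq> 0" for t
  proof
    assume "\<gamma> t = 0"
    then have "u t = (t\<^sup>2 * \<mu> t) *\<^sub>R comb \<delta> (u t)" by (simp add: \<gamma>_def)
    then have "u t \<bullet> u t = (t\<^sup>2 * \<mu> t) * (comb \<delta> (u t) \<bullet> u t)" by (metis inner_scaleR_left)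
    then have "n t = \<mu> t * t ^ 4 * D" by (simp add: uu Cu power4_eq_xxxx power2_eq_square mult_ac)
    then show False using \<mu>D[of t] r_pos[of t] by simp
  qed
  have quad: "P a (\<gamma> t) \<bullet> \<gamma> t = 0" if a: "a \<in> J" for a t
  proof -
    let ?C = "comb \<delta> (u t)" and ?l = "t\<^sup>2 * \<mu> t"
    have "P a ?C \<bullet> ?C = (2 * \<delta> a) * (u t \<bullet> ?C) - comb \<delta> (P a (u t)) \<bullet> ?C"
      using P_comb_anticommute[OF a, of \<delta> "u t"]
      by (metis add_diff_cancel_right' inner_diff_left inner_scaleR_left)
    also have "comb \<delta> (P a (u t)) \<bullet> ?C = D * (P a (u t) \<bullet> u t)"
      by (simp add: comb_sym comb_comb D_def)
    finally have PCC: "P a ?C \<bullet> ?C = \<delta> a * t\<^sup>2 * D"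
      using Cu[of t] Pu[OF a, of t] by (simp add: inner_commute)
    have PuC: "P a (u t) \<bullet> ?C = \<delta> a * n t" by (simp add: P_inner_comb[OF a] uu)
    have expand: "(A - k *\<^sub>R B) \<bullet> (U - k *\<^sub>R C) = A \<bullet> U - k * (A \<bullet> C) - k * (B \<bullet> U) + k\<^sup>2 * (B \<bullet> C)"
      for A B U C :: 'a and k
      by (simp add: inner_diff_left inner_diff_right power2_eq_square algebra_simps)
    have "P a (\<gamma> t) = P a (u t) - ?l *\<^sub>R P a ?C"
      using P_linear[OF a] by (simp add: \<gamma>_def linear_diff linear_scale)
    then have "P a (\<gamma> t) \<bullet> \<gamma> t =
        P a (u t) \<bullet> u t - 2 * ?l * (P a (u t) \<bullet> ?C) + ?l\<^sup>2 * (P a ?C \<bullet> ?C)"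
      using P_sym[OF a, of ?C "u t"] expand[of "P a (u t)" ?l "P a ?C" "u t" ?C]
      by (simp add: \<gamma>_def[of t] inner_commute)
    also have "\<dots> = \<delta> a * t\<^sup>2 * (1 - 2 * \<mu> t * n t + (\<mu> t)\<^sup>2 * t ^ 4 * D)"
      unfolding Pu[OF a] PuC PCC by (simp add: algebra_simps power2_eq_square power4_eq_xxxx)
    finally show ?thesis by (simp only: key mult_zero_right)
  qed
  have sm_n: "smooth_on UNIV n" unfolding n_def by (intro smooth_intros) auto
  have sm_r: "smooth_on UNIV r" unfolding r_def
    by (intro smooth_on_powr smooth_intros sm_n) (use rad in auto)
  have sm_\<mu>: "smooth_on UNIV \<mu>" unfolding \<mu>_def
    by (intro smooth_on_powr smooth_intros sm_n sm_r) (use n_pos r_pos add_pos_pos in auto)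
  have sm: "smooth_on UNIV (\<lambda>t. - \<mu> t *\<^sub>R comb \<delta> (u t))"
    unfolding u_def by (intro smooth_intros smooth_on_compose_linear[OF linear_comb] sm_\<mu>) auto
  have \<gamma>_eq: "p + t *\<^sub>R v + t\<^sup>2 *\<^sub>R (- \<mu> t *\<^sub>R comb \<delta> (u t)) = \<gamma> t" for t
    by (simp add: \<gamma>_def u_def)
  show ?thesis
  proof (rule tangent_spaceI[OF _ v(1) sm], unfold \<gamma>_eq)
    show "sgn (\<gamma> t) \<in> quadrics" for t
      using ne quad by (simp add: quadrics_def P_sgn_inner norm_sgn)
  qed (use ne quadricsD[OF p] in auto)
qed

lemma tangent_space_quadrics: "tangent_space quadrics p = range (proj_quadrics p)"
proof -
  have "p \<bullet> v = 0 \<and> (\<forall>a\<in>J. P a p \<bullet> v = 0)" if v: "v \<in> tangent_space quadrics p" for v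
  proof
    have "((\<lambda>x. x \<bullet> x - 1) has_derivative (\<lambda>v. 2 * (p \<bullet> v))) (at p)"
      by (auto intro!: derivative_eq_intros simp: inner_commute)
    from tangent_space_annihilates[OF this _ p v] show "p \<bullet> v = 0"
      using quadricsD(1) by simp
    show "\<forall>a\<in>J. P a p \<bullet> v = 0"
      using tangent_space_annihilates[OF has_derivative_q _ p v] quadricsD(3) by auto
  qed
  then show ?thesis
    unfolding range_projector[OF orthogonal_projector_quadrics] proj_quadrics_eq_iff
    using quadrics_tangent_curve by blast
qed

end

lemma smooth_submanifold_quadrics:
  assumes "d + 1 + card J = DIM('a)"
  shows "smooth_submanifold d quadrics"
proof (rule smooth_submanifoldI)
  fix p assume p: "p \<in> quadrics"
  note pD = quadricsD[OF p]
  \<comment> \<open>All equations are packed into one vector by means of the orthonormal normal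
    frame at \<open>p\<close>. So \<open>F\<close> is normal-valued everywhere, and its differential
    at \<open>p\<close> is twice the normal projector.\<close>
  define F where "F x = (x \<bullet> x - 1) *\<^sub>R p + (\<Sum>a\<in>J. (P a x \<bullet> x) *\<^sub>R P a p)" for x
  define D where "D v = (2 * (p \<bullet> v)) *\<^sub>R p + (\<Sum>a\<in>J. (2 * (P a p \<bullet> v)) *\<^sub>R P a p)" for v
  have "((\<lambda>x. x \<bullet> x - 1) has_derivative (\<lambda>v. 2 * (p \<bullet> v))) (at p)"
    by (auto intro!: derivative_eq_intros simp: inner_commute)
  then have der: "(F has_derivative D) (at p)"
    unfolding F_def D_def
    by (intro has_derivative_add has_derivative_sum has_derivative_scaleR_left has_derivative_q)
  have normal: "proj_quadrics p (c *\<^sub>R p + (\<Sum>a\<in>J. k a *\<^sub>R P a p)) = 0" for c k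
  proof -
    have "p \<bullet> comb k p = 0" using pD by (simp add: inner_comb_self)
    moreover have "comb (\<lambda>a. P a p \<bullet> (c *\<^sub>R p + comb k p)) p = comb k p"
      unfolding comb_def[of "\<lambda>a. P a p \<bullet> _"] using pD
      by (simp add: inner_add_right P_inner_comb) (simp add: comb_def)
    ultimately show ?thesis
      unfolding comb_def[of k, symmetric] proj_quadrics_def
      using pD by (simp add: inner_add_right)
  qed
  have DW: "D w = 2 *\<^sub>R (w - proj_quadrics p w)" for w
    by (simp add: D_def proj_quadrics_def comb_def scaleR_sum_right scaleR_add_right)
  show "\<exists>U F D \<pi>. open U \<and> p \<in> U \<and> smooth_on U F \<and>
      (F has_derivative D) (at p) \<and> orthogonal_projector \<pi> \<and> trace_of \<pi> = real d \<and>
      (\<forall>w. \<pi> (D w) = 0) \<and> (\<forall>w. \<pi> w = 0 \<longrightarrow> D w = 0 \<longrightarrow> w = 0) \<and>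
      (\<forall>x\<in>U. x \<in> quadrics \<longleftrightarrow> F x = \<pi> (F x))"
  proof (rule exI[of _ UNIV], rule exI[of _ F], rule exI[of _ D], rule exI[of _ "proj_quadrics p"],
      intro conjI allI ballI impI)
    show "smooth_on UNIV F" unfolding F_def by (intro smooth_intros smooth_on_P) auto
    show "trace_of (proj_quadrics p) = real d"
      using trace_proj_quadrics[OF p] assms by linarith
    show "proj_quadrics p (D w) = 0" for w unfolding D_def by (rule normal)
    show "w = 0" if "proj_quadrics p w = 0" "D w = 0" for w
      using that DW[of w] by simp
    fix x
    have "x \<in> quadrics \<longleftrightarrow> F x = 0"
    proof
      assume "F x = 0"
      then have z: "p \<bullet> F x = 0" "P a p \<bullet> F x = 0" for a by auto
      have F: "F x = (x \<bullet> x - 1) *\<^sub>R p + comb (\<lambda>a. P a x \<bullet> x) p" by (simp add: F_def comb_def)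
      have "p \<bullet> comb k p = 0" for k using pD by (simp add: inner_comb_self)
      then have "x \<bullet> x = 1" using z(1) pD by (simp add: F inner_add_right)
      moreover have "P a x \<bullet> x = 0" if "a \<in> J" for a
        using z(2)[of a] P_inner_comb[OF that, of p "\<lambda>a. P a x \<bullet> x"] pD that
        by (simp add: F inner_add_right)
      ultimately show "x \<in> quadrics" by (simp add: quadrics_def norm_eq_1)
    qed (simp add: F_def quadricsD)
    then show "x \<in> quadrics \<longleftrightarrow> F x = proj_quadrics p (F x)"
      using normal unfolding F_def by simp
  qed (auto simp: der orthogonal_projector_quadrics[OF p])
qed

text \<open>Only \<open>- (p \<bullet> w) *\<^sub>R v\<close> contributes to the trace: the rank-one
  terms pair a tangent vector with \<open>p\<close> or \<open>P a p\<close>, and the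
  \<open>P a\<close> terms have trace 0 by \<open>trace_P_proj_quadrics\<close>.\<close>

lemma laplacian_quadrics:
  assumes p: "p \<in> quadrics"
  shows "laplacian quadrics (\<lambda>x. x \<bullet> w) p = - (real DIM('a) - 1 - real (card J)) * (p \<bullet> w)"
proof -
  note pD = quadricsD[OF p] and \<pi> = orthogonal_projector_quadrics[OF p]
  let ?\<pi> = "proj_quadrics p"
  define L where "L v = - ((v \<bullet> w) *\<^sub>R p) - (p \<bullet> w) *\<^sub>R v -
      (\<Sum>a\<in>J. (P a v \<bullet> w) *\<^sub>R P a p + (P a p \<bullet> w) *\<^sub>R P a v)" for v
  note [derivative_intros] = has_derivative_P
  have der: "((\<lambda>x. proj_quadrics x w) has_derivative L) (at p)"
    unfolding proj_quadrics_def comb_def L_def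
    by (auto intro!: derivative_eq_intros simp: algebra_simps)
  have \<pi>p: "?\<pi> v \<bullet> p = 0" "a \<in> J \<Longrightarrow> ?\<pi> v \<bullet> P a p = 0" for a v
    using proj_quadrics_normal[OF p] by (auto simp: inner_commute)
  have "L (?\<pi> v) = - ((v \<bullet> ?\<pi> w) *\<^sub>R p) - (p \<bullet> w) *\<^sub>R ?\<pi> v -
      (\<Sum>a\<in>J. (v \<bullet> ?\<pi> (P a w)) *\<^sub>R P a p + (P a p \<bullet> w) *\<^sub>R P a (?\<pi> v))" for v
    unfolding L_def using projector_sym[OF \<pi>] P_sym by (simp cong: sum.cong)
  then have "trace_of (\<lambda>v. L (?\<pi> v)) = - (real DIM('a) - 1 - real (card J)) * (p \<bullet> w)"
    by (simp add: trace_of_simps trace_P_proj_quadrics[OF p] trace_proj_quadrics[OF p] \<pi>p)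
      (simp add: algebra_simps)
  then show ?thesis
    using laplacian_inner_eq_trace[OF \<pi> tangent_space_quadrics[OF p] p
        orthogonal_projector_quadrics tangent_space_quadrics der] by simp
qed

end

context clifford_family
begin

subsection \<open>The focal sets of the second kind\<close>

lemma comb_add_coeffs: "comb (\<lambda>a. c a + d a) x = comb c x + comb d x"
  and comb_diff_coeffs: "comb (\<lambda>a. c a - d a) x = comb c x - comb d x"
  and comb_scale_coeffs: "comb (\<lambda>a. k * c a) x = k *\<^sub>R comb c x"
  by (simp_all add: comb_def sum.distrib sum_subtractf scaleR_sum_right scaleR_add_left scaleR_diff_left)

lemma norm_comb: "norm (comb c x) = sqrt (\<Sum>a\<in>J. (c a)\<^sup>2) * norm x"
  using comb_inner_comb[of c x c] by (simp add: norm_eq_sqrt_inner real_sqrt_mult power2_eq_square)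

lemma trace_comb: "trace_of (comb c) = 0"
  unfolding comb_def by (simp add: trace_of_simps trace_P)

lemma trace_P_P:
  assumes "a \<in> J" "b \<in> J"
  shows "trace_of (\<lambda>x. P a (P b x)) = (if a = b then real DIM('a) else 0)"
proof -
  have "trace_of (\<lambda>x. P a (P b x)) = trace_of (\<lambda>x. P b (P a x))"
    unfolding trace_of_def P_sym[OF assms(1), of "P b _"] P_sym[OF assms(2), of "P a _"]
    by (simp add: inner_commute)
  moreover have "trace_of (\<lambda>x. P a (P b x)) + trace_of (\<lambda>x. P b (P a x)) =
      trace_of (\<lambda>x::'a. (if a = b then 2 else 0) *\<^sub>R x)"
    unfolding trace_of_add[symmetric] P_anticommute[OF assms] by (rule refl)
  ultimately show ?thesis by (simp only: trace_of_simps) auto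
qed

definition qform :: "'a \<Rightarrow> nat \<Rightarrow> real" where
  "qform x a = P a x \<bullet> x"

definition focal :: "'a set" where
  "focal = {x \<in> sphere 0 1. (\<Sum>a\<in>J. (qform x a)\<^sup>2) = 1}"

text \<open>For \<open>x\<close> in \<open>focal\<close>, the projector onto the +1-eigenspace of
  \<open>comb (qform x)\<close> plus the projector onto the span of the \<open>P a x\<close>. The
  two subspaces share exactly the line of \<open>x\<close>, which is counted twice and is not
  tangent; hence the coefficient 2.\<close>

definition proj_focal :: "'a \<Rightarrow> 'a \<Rightarrow> 'a" where
  "proj_focal x v = (1/2) *\<^sub>R (v + comb (qform x) v) + comb (\<lambda>a. P a x \<bullet> v) x - (2 * (x \<bullet> v)) *\<^sub>R x"

lemma comb_qform_inner: "comb c x \<bullet> x = (\<Sum>a\<in>J. c a * qform x a)"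
    "x \<bullet> comb c x = (\<Sum>a\<in>J. c a * qform x a)"
  by (simp_all add: comb_inner_self inner_comb_self qform_def)

text \<open>For a unit vector the sum of squares is both \<open>comb (qform x) x \<bullet> x\<close>
  and the squared norm of \<open>comb (qform x) x\<close>, so the value 1 is the equality case of
  Cauchy-Schwarz. Conversely the fixed-point equation forces unit length. It replaces a degenerate
  scalar equation by a vector equation that can be linearised.\<close>

lemma focal_iff: "x \<in> focal \<longleftrightarrow> x \<noteq> 0 \<and> comb (qform x) x = x"
proof
  assume x: "x \<in> focal"
  then have 1: "x \<bullet> x = 1"
    "(\<Sum>a\<in>J. (qform x a)\<^sup>2) = 1" by (auto simp: focal_def norm_eq_1)
  let ?y = "comb (qform x) x"
  have "(?y - x) \<bullet> (?y - x) = 0"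
    using 1 by (simp add: inner_diff_left inner_diff_right comb_inner_comb comb_qform_inner power2_eq_square)
  then show "x \<noteq> 0 \<and> ?y = x" using 1 by auto
next
  assume x: "x \<noteq> 0 \<and> comb (qform x) x = x"
  define h where "h = (\<Sum>a\<in>J. (qform x a)\<^sup>2)"
  have "h * (x \<bullet> x) = x \<bullet> x"
    using comb_inner_comb[of "qform x" x "qform x"] x by (simp add: h_def power2_eq_square)
  then have h: "h = 1" using x by simp
  moreover have "x \<bullet> x = h"
    using comb_qform_inner(1)[of "qform x" x] x by (simp add: h_def power2_eq_square)
  ultimately show "x \<in> focal" by (simp add: focal_def h_def norm_eq_1)
qed

text \<open>If a unit combination fixes \<open>x\<close>, pairing with \<open>P a\<close> shows that
  its coefficients are those of \<open>qform (sgn x)\<close>. Thus membership can be tested with any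
  convenient \<open>r\<close>.\<close>

lemma sgn_in_focal:
  assumes "x \<noteq> 0" "comb r x = x" "(\<Sum>a\<in>J. (r a)\<^sup>2) = 1"
  shows "sgn x \<in> focal"
proof -
  have s: "comb r (sgn x) = sgn x" "sgn x \<bullet> sgn x = 1"
    using assms linear_scale[OF linear_comb]
    by (simp_all add: sgn_div_norm) (simp flip: power2_norm_eq_inner add: power2_eq_square field_simps)
  have "qform (sgn x) a = r a" if "a \<in> J" for a
    using P_inner_comb[OF that, of "sgn x" r] s by (simp add: qform_def)
  then show ?thesis using s assms(3) by (simp add: focal_def norm_eq_1)
qed

lemma continuous_on_qform: "a \<in> J \<Longrightarrow> continuous_on S (\<lambda>x. qform x a)"
  unfolding qform_def by (rule continuous_on_q)

lemma compact_focal: "compact focal"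
proof -
  have "focal = sphere 0 1 \<inter> {x. (\<Sum>a\<in>J. (qform x a)\<^sup>2) = 1}"
    by (auto simp: focal_def)
  moreover have "closed {x. (\<Sum>a\<in>J. (qform x a)\<^sup>2) = 1}"
    by (intro closed_Collect_eq continuous_intros continuous_on_qform)
  ultimately show ?thesis by (auto intro!: compact_Int_closed)
qed

text \<open>This is the infinitesimal invariance of \<open>x - comb (qform x) x\<close> under the Spin group.\<close>

lemma defect_orthogonal_spin:
  assumes "(\<Sum>a\<in>J. c a * d a) = 0"
  shows "(x - comb (qform x) x) \<bullet> comb c (comb d x) = 0"
proof -
  let ?q = "qform x"
  let ?s = "\<lambda>c d. \<Sum>a\<in>J. c a * d a"
  have anti: "comb c (comb d y) = (2 * ?s c d) *\<^sub>R y - comb d (comb c y)" for c d y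
    using comb_anticommute[of c d y] by (simp add: algebra_simps)
  have lin: "comb c (y - z) = comb c y - comb c z" "comb c (k *\<^sub>R y) = k *\<^sub>R comb c y" for c k y z
    using linear_diff[OF linear_comb] linear_scale[OF linear_comb] by auto
  \<comment> \<open>Moving \<open>comb ?q\<close> through both factors leaves two linear terms.
    Paired with \<open>x\<close> they both become \<open>2 * ?s ?q c * ?s ?q d\<close> with opposite
    signs and cancel; what remains says that a number equals its negative.\<close>
  have "comb ?q (comb c (comb d x)) =
      (2 * ?s ?q c) *\<^sub>R comb d x - (2 * ?s ?q d) *\<^sub>R comb c x + comb c (comb d (comb ?q x))"
    using anti[of ?q c "comb d x"] anti[of ?q d x] by (simp add: lin)
  also have "comb c (comb d (comb ?q x)) = - comb d (comb c (comb ?q x))"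
    using anti[of c d "comb ?q x"] assms by simp
  finally have "x \<bullet> comb ?q (comb c (comb d x)) =
      2 * ?s ?q c * (x \<bullet> comb d x) - 2 * ?s ?q d * (x \<bullet> comb c x) - x \<bullet> comb d (comb c (comb ?q x))"
    by (simp add: inner_add_right inner_diff_right)
  moreover have "x \<bullet> comb d (comb c (comb ?q x)) = comb ?q x \<bullet> comb c (comb d x)"
    using comb_sym[of d x "comb c (comb ?q x)"] comb_sym[of c "comb d x" "comb ?q x"]
    by (simp add: inner_commute)
  moreover have "x \<bullet> comb ?q (comb c (comb d x)) = comb ?q x \<bullet> comb c (comb d x)"
    using comb_sym[of ?q x "comb c (comb d x)"] by simp
  ultimately have "comb ?q x \<bullet> comb c (comb d x) = 0"
    by (simp add: comb_qform_inner mult_ac)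
  moreover have "x \<bullet> comb c (comb d x) = 0"
    using comb_sym[of c x "comb d x"] comb_inner_comb[of c x d] assms by simp
  ultimately show ?thesis by (simp add: inner_diff_left)
qed

section \<open>The tangent projector, curves and defect equation at a point of the focal set\<close>

context
  fixes p assumes p: "p \<in> focal"
begin

abbreviation (input) "Q \<equiv> comb (qform p)"

definition "eigen_proj v = (1/2) *\<^sub>R (v + Q v)"
definition "frame_proj v = comb (\<lambda>a. P a p \<bullet> v) p"
definition "radial_proj v = (p \<bullet> v) *\<^sub>R p"

lemma focal_unit: "p \<bullet> p = 1" "norm p = 1" "(\<Sum>a\<in>J. (qform p a)\<^sup>2) = 1" "Q p = p"
  using p focal_iff[of p] by (auto simp: focal_def norm_eq_1)

lemma Q_Q: "Q (Q v) = v"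
  by (simp add: comb_comb focal_unit)

lemma linear_eigen_proj: "linear eigen_proj" and linear_frame_proj: "linear frame_proj" and linear_radial_proj: "linear radial_proj"
proof -
  show "linear eigen_proj" unfolding eigen_proj_def
    by (intro linear_compose_scale_right linear_compose_add linear_ident linear_comb)
  show "linear frame_proj" unfolding frame_proj_def comb_def
    by (rule linearI) (simp_all add: inner_add_right scaleR_add_left sum.distrib scaleR_sum_right)
  show "linear radial_proj" unfolding radial_proj_def
    by (rule linearI) (simp_all add: inner_add_right scaleR_add_left)
qed

lemma proj_focal_eq: "proj_focal p v = eigen_proj v + frame_proj v - 2 *\<^sub>R radial_proj v"
  by (simp add: proj_focal_def eigen_proj_def frame_proj_def radial_proj_def)

lemma eigen_proj_sym: "eigen_proj v \<bullet> w = v \<bullet> eigen_proj w" and frame_proj_sym: "frame_proj v \<bullet> w = v \<bullet> frame_proj w" and radial_proj_sym: "radial_proj v \<bullet> w = v \<bullet> radial_proj w"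
  by (simp add: eigen_proj_def inner_add_left inner_add_right comb_sym)
    (simp_all add: frame_proj_def radial_proj_def comb_def inner_sum_left inner_sum_right inner_commute mult.commute)

lemma projs_center: "eigen_proj p = p" "frame_proj p = p" "radial_proj p = p"
    "p \<bullet> eigen_proj v = p \<bullet> v" "p \<bullet> frame_proj v = p \<bullet> v"
proof -
  show Ep: "eigen_proj p = p" by (simp add: eigen_proj_def focal_unit scaleR_2[symmetric])
  show Sp: "frame_proj p = p" using focal_unit(4) by (simp add: frame_proj_def qform_def[abs_def])
  show "radial_proj p = p" by (simp add: radial_proj_def focal_unit)
  show "p \<bullet> eigen_proj v = p \<bullet> v" "p \<bullet> frame_proj v = p \<bullet> v"
    using eigen_proj_sym[of p v] frame_proj_sym[of p v] Ep Sp by auto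
qed

lemma sum_qform_p: "(\<Sum>a\<in>J. qform p a * (P a p \<bullet> v)) = p \<bullet> v"
  using comb_inner_self[of "qform p" p v] focal_unit(4) by simp

text \<open>As \<open>Q p = p\<close>, anticommutation makes \<open>Q (P a p)\<close> equal to
  \<open>- P a p\<close> up to a multiple of \<open>p\<close>: modulo \<open>p\<close>, the frame
  lies in the -1-eigenspace of \<open>Q\<close>. This is why the two parts of the tangent space are
  orthogonal.\<close>

lemma eigen_proj_P: "a \<in> J \<Longrightarrow> eigen_proj (P a p) = qform p a *\<^sub>R p"
  using P_comb_anticommute[of a "qform p" p] focal_unit(4)
  by (simp add: eigen_proj_def)

lemma frame_proj_P: "a \<in> J \<Longrightarrow> frame_proj (P a p) = P a p"
proof -
  assume a: "a \<in> J"
  have "frame_proj (P a p) = (\<Sum>b\<in>J. if a = b then P a p else 0)"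
    unfolding frame_proj_def comb_def using a focal_unit by (intro sum.cong) (auto simp: P_inner_P)
  then show ?thesis using a finite_J by simp
qed

text \<open>The multiplication table from which
  \<open>eigen_proj + frame_proj - 2 radial_proj\<close> is seen to be idempotent.\<close>

lemma projs_compose: "eigen_proj (eigen_proj v) = eigen_proj v"
    "frame_proj (frame_proj v) = frame_proj v" "radial_proj (radial_proj v) = radial_proj v"
    "eigen_proj (frame_proj v) = radial_proj v" "frame_proj (eigen_proj v) = radial_proj v"
  "eigen_proj (radial_proj v) = radial_proj v" "radial_proj (eigen_proj v) = radial_proj v"
    "frame_proj (radial_proj v) = radial_proj v" "radial_proj (frame_proj v) = radial_proj v"
proof -
  show "eigen_proj (eigen_proj v) = eigen_proj v"
  proof -
    have "Q (eigen_proj v) = eigen_proj v"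
      by (simp add: eigen_proj_def linear_add[OF linear_comb] linear_scale[OF linear_comb] Q_Q add.commute)
    then show ?thesis by (subst eigen_proj_def) (simp add: scaleR_2[symmetric])
  qed
  have lin: "f (comb c p) = (\<Sum>a\<in>J. c a *\<^sub>R f (P a p))" if "linear f" for f :: "'a \<Rightarrow> 'a" and c
    by (simp add: comb_def linear_sum[OF that] linear_scale[OF that])
  show "frame_proj (frame_proj v) = frame_proj v"
    by (subst (2) frame_proj_def, subst lin[OF linear_frame_proj]) (simp add: frame_proj_P, simp add: frame_proj_def comb_def)
  show ES: "eigen_proj (frame_proj v) = radial_proj v" for v
    by (subst frame_proj_def, subst lin[OF linear_eigen_proj])
      (simp add: eigen_proj_P radial_proj_def scaleR_sum_left[symmetric] sum_qform_p[symmetric] mult.commute cong: sum.cong)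
  show "frame_proj (eigen_proj v) = radial_proj v"
    using ES frame_proj_sym eigen_proj_sym radial_proj_sym by (metis vector_eq_rdot)
  show "radial_proj (radial_proj v) = radial_proj v" "eigen_proj (radial_proj v) = radial_proj v"
    "radial_proj (eigen_proj v) = radial_proj v" "frame_proj (radial_proj v) = radial_proj v"
    "radial_proj (frame_proj v) = radial_proj v"
    by (simp_all add: radial_proj_def projs_center linear_scale[OF linear_eigen_proj] linear_scale[OF linear_frame_proj] focal_unit)
qed

lemma orthogonal_projector_focal: "orthogonal_projector (proj_focal p)"
proof -
  have "linear (proj_focal p)"
    unfolding proj_focal_eq
    by (intro linear_compose_sub linear_compose_add linear_compose_scale_right linear_eigen_proj linear_frame_proj linear_radial_proj)
  moreover have "proj_focal p x \<bullet> y = x \<bullet> proj_focal p y" for x y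
    by (simp add: proj_focal_eq inner_diff_left inner_diff_right inner_add_left inner_add_right
        eigen_proj_sym frame_proj_sym radial_proj_sym)
  moreover have "proj_focal p (proj_focal p x) = proj_focal p x" for x
    by (simp add: proj_focal_eq projs_compose linear_add[OF linear_eigen_proj] linear_diff[OF linear_eigen_proj]
        linear_scale[OF linear_eigen_proj] linear_add[OF linear_frame_proj] linear_diff[OF linear_frame_proj]
        linear_scale[OF linear_frame_proj] linear_add[OF linear_radial_proj] linear_diff[OF linear_radial_proj]
        linear_scale[OF linear_radial_proj] scaleR_2)
  ultimately show ?thesis by (simp add: orthogonal_projector_def)
qed

lemma proj_focal_p: "p \<bullet> proj_focal p v = 0" "proj_focal p p = 0"
  by (simp_all add: proj_focal_eq projs_center inner_diff_right inner_add_right radial_proj_def focal_unit scaleR_2)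

lemma proj_focal_P:
  assumes "a \<in> J"
  shows "proj_focal p (P a p) = P a p - qform p a *\<^sub>R p"
proof -
  have "radial_proj (P a p) = qform p a *\<^sub>R p" by (simp add: radial_proj_def qform_def inner_commute)
  then show ?thesis
    unfolding proj_focal_eq eigen_proj_P[OF assms] frame_proj_P[OF assms] scaleR_2 by simp
qed

lemma trace_proj_focal: "trace_of (proj_focal p) = real DIM('a) / 2 + real (card J) - 2"
  unfolding proj_focal_def comb_def[of "\<lambda>a. P a p \<bullet> _"]
  by (simp add: trace_of_simps trace_comb P_inner_P focal_unit
      trace_of_rank1[of "2 *\<^sub>R p" p, simplified])

text \<open>In contrast to the quadrics this trace survives. In multiples of
  \<open>qform p a\<close>, the eigenspace part gives half the dimension, the frame
  \<open>2 - card J\<close>, and the radial part -2.\<close>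

lemma trace_P_proj_focal:
  assumes a: "a \<in> J"
  shows "trace_of (\<lambda>v. P a (proj_focal p v)) = qform p a * (real DIM('a) / 2 - real (card J))"
proof -
  have eq: "P a (proj_focal p v) = (1/2) *\<^sub>R (P a v + (\<Sum>b\<in>J. qform p b *\<^sub>R P a (P b v))) +
      (\<Sum>b\<in>J. (P b p \<bullet> v) *\<^sub>R P a (P b p)) - 2 *\<^sub>R ((p \<bullet> v) *\<^sub>R P a p)" for v
    using P_linear[OF a]
    by (simp add: proj_focal_def comb_def linear_diff linear_add linear_scale linear_sum)
  have "P b p \<bullet> P a (P b p) = (if a = b then 2 * qform p a else 0) - qform p a" if "b \<in> J" for b
  proof (cases "a = b")
    case True
    then show ?thesis using P_invol[OF a] by (simp add: qform_def)
  next
    case False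
    have "P b p \<bullet> P a (P b p) = - (P b p \<bullet> P b (P a p))"
      using P_swap[OF a that False] by simp
    also have "P b p \<bullet> P b (P a p) = p \<bullet> P a p" using P_sym[OF that] P_invol[OF that] by simp
    finally show ?thesis using False by (simp add: qform_def inner_commute)
  qed
  then have "(\<Sum>b\<in>J. P b p \<bullet> P a (P b p)) = 2 * qform p a - real (card J) * qform p a"
    using a finite_J by (simp add: sum_subtractf)
  moreover have "(\<Sum>b\<in>J. qform p b * trace_of (\<lambda>x. P a (P b x))) = qform p a * real DIM('a)"
    using a finite_J by (simp add: trace_P_P if_distrib[of "(*) _"] cong: if_cong)
  moreover have "p \<bullet> P a p = qform p a" by (simp add: qform_def inner_commute)
  ultimately show ?thesis
    unfolding eq trace_of_simps by (simp add: trace_P[OF a]) (simp add: algebra_simps)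
qed

text \<open>
  A tangent vector splits into an eigenvector \<open>w\<close> of \<open>Q\<close> and \<open>comb c p\<close> with \<open>c\<close> orthogonal to \<open>qform p\<close>;
  up to scaling, \<open>u + t comb c u = (1 + t comb c Q) u\<close> rotates \<open>u = p + t w\<close> by an element of the Spin group.
\<close>

lemma focal_tangent_curve:
  assumes v: "proj_focal p v = v"
  shows "v \<in> tangent_space focal p"
proof -
  have pv: "p \<bullet> v = 0" using proj_focal_p(1)[of v] v by simp
  then have vES: "v = eigen_proj v + frame_proj v" using v by (simp add: proj_focal_eq radial_proj_def)
  define c where "c a = P a p \<bullet> v" for a
  define w where "w = eigen_proj v"
  define N where "N = (\<Sum>a\<in>J. (c a)\<^sup>2)"
  have N0: "N \<ge> 0" by (simp add: N_def sum_nonneg)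
  have qc: "(\<Sum>a\<in>J. qform p a * c a) = 0" using sum_qform_p[of v] pv by (simp add: c_def)
  have Sv: "frame_proj v = comb c p" by (simp add: frame_proj_def c_def[abs_def])
  define u where "u t = p + t *\<^sub>R w" for t :: real
  define \<gamma> where "\<gamma> t = u t + t *\<^sub>R comb c (u t)" for t :: real
  have Qw: "Q w = w" by (simp add: w_def eigen_proj_def linear_add[OF linear_comb] linear_scale[OF linear_comb] Q_Q add.commute)
  have Qu: "Q (u t) = u t" for t
    by (simp add: u_def linear_add[OF linear_comb] linear_scale[OF linear_comb] Qw focal_unit)
  \<comment> \<open>Since \<open>c\<close> is orthogonal to \<open>qform p\<close>, the operator
    \<open>comb c\<close> anticommutes with \<open>Q\<close> and exchanges its eigenspaces.\<close>
  have QCu: "Q (comb c (u t)) = - comb c (u t)" for t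
    using comb_anticommute[of "qform p" c "u t"] by (simp add: qc Qu eq_neg_iff_add_eq_0)
  have Cuu: "comb c (u t) \<bullet> u t = 0" for t
    using comb_sym[of "qform p" "comb c (u t)" "u t"] by (simp add: Qu QCu)
  have "p \<bullet> u t = 1" for t
    using projs_center(4)[of v] pv by (simp add: u_def w_def inner_add_right focal_unit)
  then have u0: "u t \<noteq> 0" for t by (metis inner_zero_right zero_neq_one)
  have ne: "\<gamma> t \<noteq> 0" for t
  proof
    assume "\<gamma> t = 0"
    then have "\<gamma> t \<bullet> u t = 0" by simp
    then show False using u0[of t] by (simp add: \<gamma>_def inner_add_left Cuu)
  qed
  \<comment> \<open>Rational parametrisation of the circle: \<open>k t\<close> and
    \<open>k' t * sqrt N\<close> are cosine and sine of the angle whose half has tangent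
    \<open>t * sqrt N\<close>. They rotate \<open>qform p\<close> towards \<open>c\<close>, giving
    the unit combination that fixes \<open>\<gamma> t\<close>, without dividing by \<open>N\<close>,
    which may be 0.\<close>
  define k where "k t = (1 - t\<^sup>2 * N) / (1 + t\<^sup>2 * N)" for t
  define k' where "k' t = 2 * t / (1 + t\<^sup>2 * N)" for t
  have den: "1 + t\<^sup>2 * N > 0" for t using N0 by (simp add: add_pos_nonneg)
  have kk: "(k t)\<^sup>2 + (k' t)\<^sup>2 * N = 1" for t
  proof -
    have "(1 - t\<^sup>2 * N)\<^sup>2 + (2 * t)\<^sup>2 * N = (1 + t\<^sup>2 * N)\<^sup>2"
      by (simp add: power2_eq_square algebra_simps)
    then show ?thesis
      unfolding k_def k'_def power_divide times_divide_eq_left add_divide_distrib[symmetric]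
      using den[of t] by simp
  qed
  have k1: "k t + k' t * t * N = 1" "k' t - k t * t = t" for t
  proof -
    define e where "e = 1 + t\<^sup>2 * N"
    have e: "e > 0" "t\<^sup>2 * N = e - 1" using den[of t] by (simp_all add: e_def)
    have k: "k t = 2 / e - 1" "k' t = 2 / e * t"
      unfolding k_def k'_def e(2) using e(1) by (simp_all add: diff_divide_distrib)
    have "2 / e * t * t * N = 2 - 2 / e"
      using e by (simp add: mult.assoc power2_eq_square) (simp add: right_diff_distrib diff_divide_distrib)
    then show "k t + k' t * t * N = 1" "k' t - k t * t = t"
      unfolding k by (simp_all add: left_diff_distrib)
  qed
  have C\<gamma>: "comb (\<lambda>a. k t * qform p a + k' t * c a) (\<gamma> t) = \<gamma> t" for t
  proof -
    have "comb (\<lambda>a. k t * qform p a + k' t * c a) (\<gamma> t) =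
        k t *\<^sub>R (u t - t *\<^sub>R comb c (u t)) + k' t *\<^sub>R (comb c (u t) + (t * N) *\<^sub>R u t)"
      by (simp add: comb_add_coeffs comb_scale_coeffs \<gamma>_def linear_add[OF linear_comb]
          linear_scale[OF linear_comb] Qu QCu comb_comb N_def)
    also have "\<dots> = (k t + k' t * t * N) *\<^sub>R u t + (k' t - k t * t) *\<^sub>R comb c (u t)"
      by (simp add: algebra_simps)
    finally show ?thesis unfolding k1 by (simp add: \<gamma>_def)
  qed
  have "(\<Sum>a\<in>J. (k t * qform p a + k' t * c a)\<^sup>2) =
      (k t)\<^sup>2 * (\<Sum>a\<in>J. (qform p a)\<^sup>2) + 2 * k t * k' t * (\<Sum>a\<in>J. qform p a * c a) + (k' t)\<^sup>2 * N" for t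
    unfolding N_def sum_distrib_left sum.distrib[symmetric]
    by (intro sum.cong) (auto simp: power2_eq_square algebra_simps)
  then have r1: "(\<Sum>a\<in>J. (k t * qform p a + k' t * c a)\<^sup>2) = 1" for t
    using kk by (simp add: focal_unit qc)
  have \<gamma>_eq: "p + t *\<^sub>R v + t\<^sup>2 *\<^sub>R comb c w = \<gamma> t" for t
    by (subst vES) (simp add: \<gamma>_def u_def w_def Sv linear_add[OF linear_comb]
        linear_scale[OF linear_comb] power2_eq_square algebra_simps)
  show ?thesis
  proof (rule tangent_spaceI[OF _ pv, of "\<lambda>t. comb c w"], unfold \<gamma>_eq)
    show "sgn (\<gamma> t) \<in> focal" for t by (rule sgn_in_focal[OF ne C\<gamma> r1])
  qed (use ne focal_unit in \<open>auto intro: smooth_intros\<close>)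
qed

abbreviation "defect_deriv v \<equiv> v - Q v - 2 *\<^sub>R frame_proj v"

lemma has_derivative_defect: "((\<lambda>x. x - comb (qform x) x) has_derivative defect_deriv) (at p)"
proof -
  have "((\<lambda>x. x - (\<Sum>a\<in>J. (P a x \<bullet> x) *\<^sub>R P a x)) has_derivative
      (\<lambda>v. v - (\<Sum>a\<in>J. (P a p \<bullet> p) *\<^sub>R P a v + (2 * (P a p \<bullet> v)) *\<^sub>R P a p))) (at p)"
    by (intro has_derivative_diff has_derivative_ident has_derivative_sum has_derivative_scaleR
        has_derivative_q has_derivative_P)
  then show ?thesis
    by (simp add: comb_def qform_def frame_proj_def sum.distrib scaleR_sum_right diff_diff_eq)
qed

text \<open>The differential is 0 on tangent vectors, 2 on normal vectors orthogonal to
  \<open>p\<close> and -2 on the line of \<open>p\<close>; its kernel is therefore exactly the range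
  of \<open>proj_focal p\<close>.\<close>

lemma defect_deriv_eq: "defect_deriv v = 2 *\<^sub>R (v - proj_focal p v) - 4 *\<^sub>R radial_proj v"
  by (simp add: proj_focal_eq eigen_proj_def algebra_simps) (simp add: scaleR_2)

lemma tangent_space_focal: "tangent_space focal p = range (proj_focal p)"
proof -
  have "proj_focal p v = v" if v: "v \<in> tangent_space focal p" for v
  proof -
    have 0: "defect_deriv v = 0"
      by (rule tangent_space_annihilates[OF has_derivative_defect _ p v]) (simp add: focal_iff)
    have "p \<bullet> defect_deriv v = - 2 * (p \<bullet> v)"
      by (simp only: defect_deriv_eq)
        (simp add: inner_diff_right proj_focal_p radial_proj_def focal_unit)
    then have "p \<bullet> v = 0" using 0 by simp
    then show ?thesis using 0 unfolding defect_deriv_eq by (simp add: radial_proj_def)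
  qed
  then show ?thesis
    unfolding range_projector[OF orthogonal_projector_focal] using focal_tangent_curve by blast
qed

text \<open>
  Near \<open>p\<close> the defect \<open>z = x - comb (qform x) x\<close> vanishes as soon as it is tangent at \<open>p\<close>: then
  \<open>z = eigen_proj z + frame_proj z\<close>, the \<open>frame_proj\<close>-part is a Spin direction up to \<open>O(norm (x - p))\<close>, and the
  \<open>eigen_proj\<close>-part is controlled through the identity \<open>z + comb (qform x) z = (1 - h) x\<close>.
\<close>

lemma defect_tangent_imp_focal:
  assumes xp: "norm (x - p) < 1/16" and qq: "(\<Sum>a\<in>J. (qform p a - qform x a)\<^sup>2) < 1"
    and tan: "proj_focal p (x - comb (qform x) x) = x - comb (qform x) x"
  shows "x \<in> focal"
proof -
  define z where "z = x - comb (qform x) x"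
  define h where "h = (\<Sum>a\<in>J. (qform x a)\<^sup>2)"
  define c where "c a = P a p \<bullet> z" for a
  have pz: "p \<bullet> z = 0" using proj_focal_p(1)[of z] tan by (simp add: z_def)
  then have zES: "z = eigen_proj z + frame_proj z" using tan by (simp add: proj_focal_eq radial_proj_def z_def)
  have nE: "norm (eigen_proj z) \<le> norm z" and nS: "norm (frame_proj z) \<le> norm z"
  proof -
    have *: "norm y \<le> norm z" if "y \<bullet> y = z \<bullet> y" for y
    proof -
      have "norm y * norm y \<le> norm z * norm y"
        by (metis norm_cauchy_schwarz power2_eq_square power2_norm_eq_inner that)
      then show ?thesis by (cases "y = 0") auto
    qed
    show "norm (eigen_proj z) \<le> norm z" by (rule *) (simp add: eigen_proj_sym projs_compose)
    show "norm (frame_proj z) \<le> norm z" by (rule *) (simp add: frame_proj_sym projs_compose)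
  qed
  have x_lower: "norm x \<ge> 1/2"
    using norm_triangle_ineq2[of p x] xp focal_unit by (simp add: norm_minus_commute)
  have diffQ: "norm (Q y - comb (qform x) y) \<le> norm y" for y
  proof -
    have "Q y - comb (qform x) y = comb (\<lambda>a. qform p a - qform x a) y"
      by (simp add: comb_diff_coeffs)
    then show ?thesis using qq real_sqrt_le_1_iff by (simp add: norm_comb mult_left_le_one_le sum_nonneg)
  qed
  have "norm (comb (qform x) z) \<le> norm (Q z) + norm (Q z - comb (qform x) z)"
    by (metis norm_minus_commute norm_triangle_sub)
  also have "norm (Q z) = norm z" by (simp add: norm_comb focal_unit)
  finally have nQ': "norm (comb (qform x) z) \<le> 2 * norm z" using diffQ[of z] by simp
  have zQ': "z + comb (qform x) z = (1 - h) *\<^sub>R x"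
    by (simp add: z_def linear_diff[OF linear_comb] comb_comb h_def scaleR_diff_left)
  have h_bound: "\<bar>1 - h\<bar> \<le> 6 * norm z"
  proof -
    have "\<bar>1 - h\<bar> * (1/2) \<le> \<bar>1 - h\<bar> * norm x" using x_lower by (intro mult_left_mono) auto
    also have "\<dots> = norm (z + comb (qform x) z)" by (simp add: zQ')
    also have "\<dots> \<le> 3 * norm z" using norm_triangle_ineq[of z "comb (qform x) z"] nQ' by simp
    finally show ?thesis by simp
  qed
  have "z \<bullet> frame_proj z \<le> norm z * (norm z * norm (p - x))"
  proof -
    \<comment> \<open>\<open>frame_proj z\<close> is \<open>comb c (Q p)\<close>. The vector
      \<open>comb c (Q x)\<close> is a Spin direction at \<open>x\<close>, hence orthogonal to
      \<open>z\<close>, and only the difference \<open>p - x\<close> contributes.\<close>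
    have "(\<Sum>a\<in>J. c a * qform p a) = 0" using sum_qform_p[of z] pz by (simp add: c_def mult.commute)
    from defect_orthogonal_spin[OF this] have "z \<bullet> comb c (Q x) = 0" by (simp add: z_def)
    then have "z \<bullet> frame_proj z = z \<bullet> comb c (Q (p - x))"
      by (simp add: frame_proj_def c_def[abs_def, symmetric] linear_diff[OF linear_comb] inner_diff_right focal_unit)
    also have "\<dots> \<le> norm z * norm (comb c (Q (p - x)))" by (rule norm_cauchy_schwarz)
    also have "norm (comb c (Q (p - x))) = norm (frame_proj z) * norm (p - x)"
      by (simp add: frame_proj_def c_def[abs_def, symmetric] norm_comb focal_unit)
    also have "norm z * (norm (frame_proj z) * norm (p - x)) \<le> norm z * (norm z * norm (p - x))"
      using nS by (intro mult_left_mono mult_right_mono) auto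
    finally show ?thesis .
  qed
  also have "\<dots> \<le> norm z * (norm z * (1/16))"
    using xp by (intro mult_left_mono) (auto simp: norm_minus_commute)
  finally have zS: "z \<bullet> frame_proj z \<le> (norm z)\<^sup>2 / 16" by (simp add: power2_eq_square)
  have zE: "z \<bullet> eigen_proj z \<le> (11/16) * (norm z)\<^sup>2"
  proof -
    \<comment> \<open>Because \<open>p \<bullet> eigen_proj z = 0\<close>, the first term is felt
      only through \<open>x - p\<close> and contributes at most 6/16; the second contributes at most
      1.\<close>
    have "2 *\<^sub>R eigen_proj z = (1 - h) *\<^sub>R x + (Q z - comb (qform x) z)"
      by (simp add: eigen_proj_def zQ'[symmetric])
    then have "2 * (eigen_proj z \<bullet> eigen_proj z) = (1 - h) * (x \<bullet> eigen_proj z) + (Q z - comb (qform x) z) \<bullet> eigen_proj z"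
      by (metis inner_add_left inner_scaleR_left)
    also have "x \<bullet> eigen_proj z = (x - p) \<bullet> eigen_proj z" using projs_center(4)[of z] pz by (simp add: inner_diff_left)
    also have "(1 - h) * ((x - p) \<bullet> eigen_proj z) \<le> (6 * norm z) * ((1/16) * norm z)"
    proof -
      have "(1 - h) * ((x - p) \<bullet> eigen_proj z) \<le> \<bar>1 - h\<bar> * \<bar>(x - p) \<bullet> eigen_proj z\<bar>"
        by (metis abs_ge_self abs_mult)
      also have "\<dots> \<le> (6 * norm z) * (norm (x - p) * norm (eigen_proj z))"
        using h_bound Cauchy_Schwarz_ineq2 by (intro mult_mono) auto
      also have "\<dots> \<le> (6 * norm z) * ((1/16) * norm z)"
        using xp nE by (intro mult_left_mono mult_mono) auto
      finally show ?thesis .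
    qed
    also have "(Q z - comb (qform x) z) \<bullet> eigen_proj z \<le> norm z * norm z"
      using norm_cauchy_schwarz[of "Q z - comb (qform x) z" "eigen_proj z"] mult_mono[OF diffQ[of z] nE]
      by simp
    finally show ?thesis
      using eigen_proj_sym[of z "eigen_proj z"] projs_compose(1)[of z] by (simp add: power2_eq_square)
  qed
  \<comment> \<open>The bounds 11/16 and 1/16 add up to less than 1; the radius 1/16 is chosen for
    this.\<close>
  have "(norm z)\<^sup>2 = z \<bullet> eigen_proj z + z \<bullet> frame_proj z"
    unfolding power2_norm_eq_inner inner_add_right[symmetric] zES[symmetric] ..
  with zE zS have "(norm z)\<^sup>2 \<le> 0" by simp
  then have "z = 0" by simp
  then show ?thesis using x_lower by (auto simp: focal_iff z_def)
qed

end

lemma smooth_submanifold_focal: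
  assumes "2 * d + 4 = DIM('a) + 2 * card J"
  shows "smooth_submanifold d focal"
proof (rule smooth_submanifoldI)
  fix p assume p: "p \<in> focal"
  define U where "U = ball p (1/16) \<inter> {x. (\<Sum>a\<in>J. (qform p a - qform x a)\<^sup>2) < 1}"
  have "open {x. (\<Sum>a\<in>J. (qform p a - qform x a)\<^sup>2) < 1}"
    by (intro open_Collect_less continuous_intros continuous_on_qform)
  then have "open U" by (simp add: U_def open_Int)
  show "\<exists>U F D \<pi>. open U \<and> p \<in> U \<and> smooth_on U F \<and>
      (F has_derivative D) (at p) \<and> orthogonal_projector \<pi> \<and> trace_of \<pi> = real d \<and>
      (\<forall>w. \<pi> (D w) = 0) \<and> (\<forall>w. \<pi> w = 0 \<longrightarrow> D w = 0 \<longrightarrow> w = 0) \<and>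
      (\<forall>x\<in>U. x \<in> focal \<longleftrightarrow> F x = \<pi> (F x))"
  proof (rule exI[of _ U], rule exI[of _ "\<lambda>x. x - comb (qform x) x"], rule exI, rule exI[of _ "proj_focal p"],
      intro conjI allI ballI impI)
    show "p \<in> U" by (simp add: U_def)
    show "smooth_on U (\<lambda>x. x - comb (qform x) x)"
      unfolding comb_def qform_def using \<open>open U\<close> by (intro smooth_intros smooth_on_P)
    show "trace_of (proj_focal p) = real d"
      using trace_proj_focal[OF p] assms by (simp add: field_simps)
    show "((\<lambda>x. x - comb (qform x) x) has_derivative (\<lambda>v. v - comb (qform p) v - 2 *\<^sub>R frame_proj p v)) (at p)"
      by (rule has_derivative_defect[OF p])
    note eq = defect_deriv_eq[OF p]
    note lin = projector_linear[OF orthogonal_projector_focal[OF p]]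
    note idem = projector_idem[OF orthogonal_projector_focal[OF p]]
    show "proj_focal p (w - comb (qform p) w - 2 *\<^sub>R frame_proj p w) = 0" for w
      unfolding eq by (simp add: linear_diff[OF lin] linear_scale[OF lin] idem radial_proj_def[OF p] proj_focal_p[OF p])
    show "w = 0" if "proj_focal p w = 0" "w - comb (qform p) w - 2 *\<^sub>R frame_proj p w = 0" for w
    proof -
      have w: "2 *\<^sub>R w = 4 *\<^sub>R radial_proj p w" using that unfolding eq by simp
      then have "2 * (p \<bullet> w) = 4 * (p \<bullet> w)"
        by (metis radial_proj_def[OF p] focal_unit(1)[OF p] inner_scaleR_right mult.right_neutral)
      then show ?thesis using w by (simp add: radial_proj_def[OF p])
    qed
    fix x assume "x \<in> U"
    then show "x \<in> focal \<longleftrightarrow> x - comb (qform x) x = proj_focal p (x - comb (qform x) x)"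
      using defect_tangent_imp_focal[OF p, of x] linear_0[OF lin]
      by (auto simp: U_def dist_norm norm_minus_commute focal_iff)
  qed (use \<open>open U\<close> orthogonal_projector_focal[OF p] in auto)
qed

text \<open>With \<open>k\<close> for \<open>card J\<close> and \<open>l\<close> for half the
  dimension, the traces are, in multiples of \<open>p \<bullet> w\<close>: \<open>k - 1\<close> from
  each of the two rank-one sums, \<open>l - k\<close> from the \<open>P a\<close> acting on tangent
  vectors, and \<open>-2 (l + k - 2)\<close> from the radial term. The total is
  \<open>-(l + k - 2)\<close>.\<close>

lemma laplacian_focal:
  assumes p: "p \<in> focal"
  shows "laplacian focal (\<lambda>x. x \<bullet> w) p = - (real DIM('a) / 2 + real (card J) - 2) * (p \<bullet> w)"
proof -
  note \<pi> = orthogonal_projector_focal[OF p]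
  let ?\<pi> = "proj_focal p"
  define L where "L v = (1/2) *\<^sub>R (\<Sum>a\<in>J. (2 * (P a p \<bullet> v)) *\<^sub>R P a w) +
      (\<Sum>a\<in>J. (P a p \<bullet> w) *\<^sub>R P a v + (P a v \<bullet> w) *\<^sub>R P a p) -
      ((2 * (p \<bullet> w)) *\<^sub>R v + (2 * (v \<bullet> w)) *\<^sub>R p)" for v
  have "((\<lambda>x. (1/2) *\<^sub>R (w + (\<Sum>a\<in>J. (P a x \<bullet> x) *\<^sub>R P a w)) + (\<Sum>a\<in>J. (P a x \<bullet> w) *\<^sub>R P a x)
      - (2 * (x \<bullet> w)) *\<^sub>R x) has_derivative
      (\<lambda>v. (1/2) *\<^sub>R (0 + (\<Sum>a\<in>J. (2 * (P a p \<bullet> v)) *\<^sub>R P a w)) +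
      (\<Sum>a\<in>J. (P a p \<bullet> w) *\<^sub>R P a v + (P a v \<bullet> w) *\<^sub>R P a p) -
      ((2 * (p \<bullet> w)) *\<^sub>R v + (2 * (v \<bullet> w)) *\<^sub>R p))) (at p)"
    by (intro has_derivative_diff has_derivative_add has_derivative_const has_derivative_scaleR_right
        has_derivative_sum has_derivative_scaleR_left has_derivative_scaleR has_derivative_q
        has_derivative_P has_derivative_inner_left has_derivative_mult_right has_derivative_ident)
  then have der: "((\<lambda>x. proj_focal x w) has_derivative L) (at p)"
    unfolding proj_focal_def comb_def qform_def L_def by simp
  have "?\<pi> v \<bullet> p = 0" for v using proj_focal_p(1)[OF p, of v] by (simp add: inner_commute)
  then have \<pi>p: "?\<pi> w \<bullet> p = 0" .
  have "?\<pi> (P a p) \<bullet> P a w = p \<bullet> w - qform p a * (P a p \<bullet> w)" if "a \<in> J" for a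
    using that P_sym[OF that] P_invol[OF that] by (simp add: proj_focal_P[OF p] inner_diff_left)
  then have "(\<Sum>a\<in>J. ?\<pi> (P a p) \<bullet> P a w) = (\<Sum>a\<in>J. p \<bullet> w - qform p a * (P a p \<bullet> w))"
    by (intro sum.cong) auto
  then have sum1: "(\<Sum>a\<in>J. ?\<pi> (P a p) \<bullet> P a w) = (real (card J) - 1) * (p \<bullet> w)"
    using sum_qform_p[OF p, of w] by (simp add: sum_subtractf algebra_simps)
  have sum2: "(\<Sum>a\<in>J. ?\<pi> (P a w) \<bullet> P a p) = (real (card J) - 1) * (p \<bullet> w)"
    unfolding sum1[symmetric] using projector_sym[OF \<pi>] by (simp add: inner_commute)
  have sum3: "(\<Sum>a\<in>J. (P a p \<bullet> w) * (qform p a * k)) = k * (p \<bullet> w)" for k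
    using sum_qform_p[OF p, of w] by (simp add: sum_distrib_left[symmetric] sum_distrib_right[symmetric] mult_ac)
  have "L (?\<pi> v) = (\<Sum>a\<in>J. (v \<bullet> ?\<pi> (P a p)) *\<^sub>R P a w) +
      (\<Sum>a\<in>J. (P a p \<bullet> w) *\<^sub>R P a (?\<pi> v)) + (\<Sum>a\<in>J. (v \<bullet> ?\<pi> (P a w)) *\<^sub>R P a p) -
      ((2 * (p \<bullet> w)) *\<^sub>R ?\<pi> v + 2 *\<^sub>R ((v \<bullet> ?\<pi> w) *\<^sub>R p))" for v
  proof -
    have "P a (?\<pi> v) \<bullet> w = v \<bullet> ?\<pi> (P a w)" if "a \<in> J" for a
      using P_sym[OF that] projector_sym[OF \<pi>] by simp
    moreover have "P a p \<bullet> ?\<pi> v = v \<bullet> ?\<pi> (P a p)" for a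
      using projector_sym[OF \<pi>, of v] by (simp add: inner_commute)
    moreover have "?\<pi> v \<bullet> w = v \<bullet> ?\<pi> w" by (rule projector_sym[OF \<pi>])
    ultimately show ?thesis
      unfolding L_def by (simp add: scaleR_sum_right sum.distrib cong: sum.cong)
  qed
  then have "trace_of (\<lambda>v. L (?\<pi> v)) = - (real DIM('a) / 2 + real (card J) - 2) * (p \<bullet> w)"
    by (simp only: trace_of_simps trace_P_proj_focal[OF p] trace_proj_focal[OF p] \<pi>p sum1 sum2 sum3
        cong: sum.cong)
      (simp add: algebra_simps)
  then show ?thesis
    using laplacian_inner_eq_trace[OF \<pi> tangent_space_focal[OF p] p
        orthogonal_projector_focal tangent_space_focal der] by simp
qed

end

subsection \<open>Focal maps\<close>

text \<open>The unit sphere is the intersection of quadrics of the empty family.\<close>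

interpretation sphere: clifford_family "{}" "\<lambda>_ x. x"
  by unfold_locales auto

lemma sphere_quadrics: "sphere.quadrics = sphere 0 1"
  by (auto simp: sphere.quadrics_def)

lemma tangent_space_sphere:
  assumes "norm p = 1"
  shows "tangent_space (sphere 0 1) p = {v. p \<bullet> v = 0}"
proof -
  have p: "p \<in> sphere.quadrics" using assms by (simp add: sphere_quadrics)
  show ?thesis
    unfolding sphere_quadrics[symmetric] sphere.tangent_space_quadrics[OF p]
      range_projector[OF sphere.orthogonal_projector_quadrics[OF p]]
    by (simp add: sphere.proj_quadrics_eq_iff[OF p])
qed

lemma smooth_submanifold_sphere: "smooth_submanifold (DIM('a) - 1) (sphere 0 1 :: 'a::euclidean_space set)"
  unfolding sphere_quadrics[symmetric]
  by (rule sphere.smooth_submanifold_quadrics) (simp add: Suc_leI)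

lemma smooth_map_linear: "linear f \<Longrightarrow> smooth_map M f"
  unfolding smooth_map_def
  by (intro ballI exI[of _ UNIV] exI[of _ f]) (auto intro: smooth_on_linear)

lemma isometric_identification_inner:
  assumes "isometric_identification E \<iota>" "subspace E" "x \<in> E" "y \<in> E"
  shows "\<iota> x \<bullet> \<iota> y = x \<bullet> y"
proof -
  have \<iota>: "linear \<iota>" "\<And>x. x \<in> E \<Longrightarrow> norm (\<iota> x) = norm x"
    using assms(1) by (auto simp: isometric_identification_def)
  have "norm (\<iota> x + \<iota> y) = norm (x + y)"
    using \<iota>(2)[OF subspace_add[OF assms(2-4)]] linear_add[OF \<iota>(1), of x y] by simp
  then show ?thesis using \<iota>(2) assms(3,4) by (simp add: dot_norm)
qed

lemma isometric_identification_bij_betw: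
  assumes "isometric_identification E \<iota>" "subspace E"
  shows "bij_betw \<iota> (E \<inter> sphere 0 1) (sphere 0 1)"
proof (rule bij_betw_imageI)
  have \<iota>: "linear \<iota>" "\<And>x. x \<in> E \<Longrightarrow> norm (\<iota> x) = norm x"
    "\<iota> ` E = UNIV"
    using assms(1) by (auto simp: isometric_identification_def)
  show "inj_on \<iota> (E \<inter> sphere 0 1)"
  proof (rule inj_onI)
    fix x y assume "x \<in> E \<inter> sphere 0 1" "y \<in> E \<inter> sphere 0 1" "\<iota> x = \<iota> y"
    then have "norm (x - y) = 0"
      using \<iota>(2)[of "x - y"] subspace_diff[OF assms(2)] linear_diff[OF \<iota>(1)] by simp
    then show "x = y" by simp
  qed
  show "\<iota> ` (E \<inter> sphere 0 1) = sphere 0 1"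
  proof
    show "sphere 0 1 \<subseteq> \<iota> ` (E \<inter> sphere 0 1)"
    proof
      fix w :: "real^'b" assume "w \<in> sphere 0 1"
      moreover obtain x where "x \<in> E" "w = \<iota> x" using \<iota>(3) by blast
      ultimately show "w \<in> \<iota> ` (E \<inter> sphere 0 1)" using \<iota>(2) by auto
    qed
  qed (use \<iota>(2) in auto)
qed

lemma linear_focal_map: "linear (focal_map A s)"
  unfolding focal_map_def
  by (intro linear_compose_scale_right linear_compose_add linear_ident matrix_vector_mul_linear)

text \<open>Supplies preimages: \<open>y\<close> in the opposite eigenspace is killed by the focal
  map and is free to be chosen so that the point lies on the submanifold.\<close>

lemma focal_map_of_eigen_sum:
  assumes "s \<in> {1, -1}" "A *v e = s *\<^sub>R e" "A *v y = (- s) *\<^sub>R y"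
  shows "focal_map A s ((1 / sqrt 2) *\<^sub>R (e + y)) = e"
proof -
  have "s *\<^sub>R (A *v (e + y)) = (s * s) *\<^sub>R e - (s * s) *\<^sub>R y"
    using assms by (simp add: matrix_vector_right_distrib scaleR_diff_right)
  moreover have "s * s = 1" using assms(1) by auto
  ultimately have "focal_map A s (e + y) = (1 / sqrt 2) *\<^sub>R (2 *\<^sub>R e)"
    by (simp add: focal_map_def scaleR_2)
  then show ?thesis
    by (simp add: linear_scale[OF linear_focal_map])
qed

section \<open>The focal map of a symmetric involution\<close>

context
  fixes A :: "real^'n^'n" and s :: real
  assumes s: "s \<in> {1, -1}"
    and A_sym: "\<And>x y. (A *v x) \<bullet> y = x \<bullet> (A *v y)"
    and A_invol: "\<And>x. A *v (A *v x) = x"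
begin

lemma s_sq: "s * s = 1" using s by auto

lemma subspace_eigenspace: "subspace (eigenspace A s)"
  by (auto simp: subspace_def eigenspace_def matrix_vector_right_distrib
      matrix_vector_mult_scaleR algebra_simps)

lemma focal_map_in_eigenspace: "focal_map A s x \<in> eigenspace A s"
  using s_sq
  by (simp add: eigenspace_def focal_map_def matrix_vector_right_distrib matrix_vector_mult_scaleR
      A_invol scaleR_add_right add.commute)

lemma focal_map_inner: "e \<in> eigenspace A s \<Longrightarrow> focal_map A s x \<bullet> e = sqrt 2 * (x \<bullet> e)"
proof -
  assume "e \<in> eigenspace A s"
  then have "(A *v x) \<bullet> e = s * (x \<bullet> e)" by (simp add: A_sym eigenspace_def)
  then have "focal_map A s x \<bullet> e = (1 / sqrt 2) * (x \<bullet> e + (s * s) * (x \<bullet> e))"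
    by (simp add: focal_map_def inner_add_left)
  then have "focal_map A s x \<bullet> e = (2 / sqrt 2) * (x \<bullet> e)" by (simp add: s_sq)
  then show ?thesis by (simp only: real_div_sqrt zero_le_numeral)
qed

lemma norm_focal_map:
  assumes "norm x = 1" "(A *v x) \<bullet> x = 0"
  shows "norm (focal_map A s x) = 1"
proof -
  have "focal_map A s x \<bullet> focal_map A s x = sqrt 2 * (x \<bullet> focal_map A s x)"
    by (rule focal_map_inner[OF focal_map_in_eigenspace])
  also have "\<dots> = x \<bullet> x + s * ((A *v x) \<bullet> x)"
    by (simp add: focal_map_def inner_add_right inner_commute)
  finally show ?thesis using assms by (simp add: norm_eq_1)
qed

text \<open>\<open>A\<close> is an isometry, so the values 1 and -1 of the quadratic form are the
  equality case of Cauchy-Schwarz.\<close>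

lemma eigenspace_cap_sphere: "eigenspace A s \<inter> sphere 0 1 = {x \<in> sphere 0 1. (A *v x) \<bullet> x = s}"
proof -
  have "x \<in> eigenspace A s" if "x \<bullet> x = 1" "(A *v x) \<bullet> x = s" for x
  proof -
    have "(A *v x) \<bullet> (A *v x) = 1" using A_sym A_invol that by simp
    then have "(A *v x - s *\<^sub>R x) \<bullet> (A *v x - s *\<^sub>R x) = 0"
      using that s_sq by (simp add: inner_diff_left inner_diff_right inner_commute)
    then show ?thesis by (simp add: eigenspace_def)
  qed
  then have "{x \<in> sphere 0 1. (A *v x) \<bullet> x = s} \<subseteq> eigenspace A s"
    by (auto simp: norm_eq_1)
  moreover have "(A *v x) \<bullet> x = s" if "x \<in> eigenspace A s \<inter> sphere 0 1" for x
    using that by (simp add: eigenspace_def norm_eq_1)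
  ultimately show ?thesis by auto
qed

lemma dim_eigenspace:
  assumes "trace_of (\<lambda>x. A *v x) = 0"
  shows "2 * dim (eigenspace A s) = CARD('n)"
proof -
  define \<pi> where "\<pi> x = (1/2) *\<^sub>R (x + s *\<^sub>R (A *v x))" for x
  have "\<pi> (\<pi> x) = \<pi> x" for x
  proof -
    have "A *v \<pi> x = s *\<^sub>R \<pi> x"
      using s_sq by (simp add: \<pi>_def matrix_vector_right_distrib matrix_vector_mult_scaleR A_invol
          scaleR_add_right add.commute)
    then have "\<pi> (\<pi> x) = (1/2) *\<^sub>R (\<pi> x + (s * s) *\<^sub>R \<pi> x)"
      by (subst \<pi>_def) simp
    then show ?thesis by (simp add: s_sq flip: scaleR_2)
  qed
  moreover have "linear \<pi>" unfolding \<pi>_def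
    by (intro linear_compose_scale_right linear_compose_add linear_ident matrix_vector_mul_linear)
  ultimately have \<pi>: "orthogonal_projector \<pi>"
    by (auto simp: orthogonal_projector_def \<pi>_def[of _] inner_add_left inner_add_right A_sym)
  have "range \<pi> = eigenspace A s"
  proof
    show "range \<pi> \<subseteq> eigenspace A s"
      using s_sq by (auto simp: eigenspace_def \<pi>_def matrix_vector_right_distrib
          matrix_vector_mult_scaleR A_invol scaleR_add_right add.commute)
    have "\<pi> x = x" if "x \<in> eigenspace A s" for x
      using that s_sq by (simp add: \<pi>_def eigenspace_def flip: scaleR_2)
    then show "eigenspace A s \<subseteq> range \<pi>" by (metis rangeI subsetI)
  qed
  then have "real (dim (eigenspace A s)) = real CARD('n) / 2"
    using dim_range_projector[OF \<pi>] assms unfolding \<pi>_def[abs_def]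
    by (simp add: trace_of_simps)
  then show ?thesis by linarith
qed

text \<open>Common to both families, whose differences are confined to the hypotheses. The
  assumption \<open>surj\<close> makes \<open>M\<close> nonempty and every component of the map
  nonzero somewhere; submersivity comes from \<open>transversal\<close>.\<close>

lemma focal_map_submersive_eigenmap:
  fixes \<iota> :: "real^'n \<Rightarrow> real^'l" and \<pi> :: "real^'n \<Rightarrow> real^'n \<Rightarrow> real^'n"
  assumes M: "compact M" "M \<subseteq> sphere 0 1" "smooth_submanifold d M"
    and \<pi>: "\<And>x. x \<in> M \<Longrightarrow> orthogonal_projector (\<pi> x)"
      "\<And>x. x \<in> M \<Longrightarrow> tangent_space M x = range (\<pi> x)"
    and lap: "\<And>x w. x \<in> M \<Longrightarrow> laplacian M (\<lambda>x. x \<bullet> w) x = - lam * (x \<bullet> w)"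
    and A0: "\<And>x. x \<in> M \<Longrightarrow> (A *v x) \<bullet> x = 0"
    and transversal: "\<And>x e. x \<in> M \<Longrightarrow> e \<in> eigenspace A s \<Longrightarrow> x \<bullet> e = 0 \<Longrightarrow> \<pi> x e = 0 \<Longrightarrow> e = 0"
    and surj: "\<And>e. e \<in> eigenspace A s \<Longrightarrow> norm e = 1 \<Longrightarrow> \<exists>x\<in>M. focal_map A s x = e"
    and \<iota>: "isometric_identification (eigenspace A s) \<iota>"
  shows "smooth_submersion M (sphere 0 1) (\<iota> \<circ> focal_map A s) \<and> eigenmap M lam (\<iota> \<circ> focal_map A s)"
proof
  let ?E = "eigenspace A s"
  define g where "g = \<iota> \<circ> focal_map A s"
  have \<iota>D: "linear \<iota>" "\<And>x. x \<in> ?E \<Longrightarrow> norm (\<iota> x) = norm x"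
    "\<iota> ` ?E = UNIV"
    using \<iota> by (auto simp: isometric_identification_def)
  have lin: "linear g"
    unfolding g_def by (rule linear_compose[OF linear_focal_map \<iota>D(1)])
  have g_inner: "g x \<bullet> \<iota> e = sqrt 2 * (x \<bullet> e)" if "e \<in> ?E" for x e
    unfolding g_def o_def
    using isometric_identification_inner[OF \<iota> subspace_eigenspace focal_map_in_eigenspace that]
      focal_map_inner[OF that] by simp
  have norm_g: "norm (g x) = 1" if "x \<in> M" for x
    using norm_focal_map[OF _ A0[OF that]] M(2) that \<iota>D(2)[OF focal_map_in_eigenspace]
    by (auto simp: g_def)
  have gM: "g ` M \<subseteq> sphere 0 1" using norm_g by auto
  show "smooth_submersion M (sphere 0 1) (\<iota> \<circ> focal_map A s)"
    unfolding smooth_submersion_def g_def[symmetric]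
  proof (intro conjI ballI)
    show "\<exists>d. smooth_submanifold d M" using M(3) by blast
    show "\<exists>d. smooth_submanifold d (sphere 0 1 :: (real^'l) set)" using smooth_submanifold_sphere by blast
    show "smooth_map M g" by (rule smooth_map_linear[OF lin])
    show "g ` M \<subseteq> sphere 0 1" by (rule gM)
    fix p assume p: "p \<in> M"
    let ?T = "tangent_space M p"
    have "bounded_linear g" using lin by (simp add: linear_conv_bounded_linear)
    then have Dg: "frechet_derivative g (at p within M) v = g v" if "v \<in> ?T" for v
      using frechet_derivative_on_tangent_space[OF bounded_linear_imp_has_derivative _ p that] by blast
    have "g ` ?T = tangent_space (sphere 0 1) (g p)"
    proof
      show sub: "g ` ?T \<subseteq> tangent_space (sphere 0 1) (g p)"
        using tangent_space_linear_image[OF lin gM] by auto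
      note TS = tangent_space_sphere[OF norm_g[OF p]]
      have subV: "subspace (g ` ?T)"
        unfolding \<pi>(2)[OF p]
        using linear_subspace_image[OF lin linear_subspace_image[OF projector_linear[OF \<pi>(1)[OF p]] subspace_UNIV]] .
      show "tangent_space (sphere 0 1) (g p) \<subseteq> g ` ?T"
      proof
        fix w assume w: "w \<in> tangent_space (sphere 0 1) (g p)"
        \<comment> \<open>The part \<open>z\<close> of \<open>w\<close> orthogonal to the image
          corresponds to an eigenvector \<open>e\<close>; by \<open>g_inner\<close> it is orthogonal
          to \<open>p\<close> and to all tangent vectors at \<open>p\<close>, so it vanishes by
          transversality.\<close>
        obtain y z where yz: "y \<in> span (g ` ?T)"
    "\<And>v. v \<in> span (g ` ?T) \<Longrightarrow> orthogonal z v" "w = y + z"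
          using orthogonal_subspace_decomp_exists[of "g ` ?T" w] by metis
        have y: "y \<in> g ` ?T" using yz(1) subV by (metis span_eq_iff)
        then have "g p \<bullet> y = 0" using sub TS by auto
        then have gz: "g p \<bullet> z = 0" using w yz(3) TS by (simp add: inner_add_right)
        obtain e where e: "e \<in> ?E" "z = \<iota> e" using \<iota>D(3) by blast
        have "p \<bullet> e = 0" using gz g_inner[OF e(1), of p] e(2) by simp
        moreover have "\<pi> p e \<bullet> v = 0" for v
        proof -
          have "\<pi> p v \<in> ?T" using \<pi>(2)[OF p] by blast
          then have "g (\<pi> p v) \<bullet> z = 0"
            using yz(2)[OF span_base] by (metis imageI inner_commute orthogonal_def)
          then have "\<pi> p v \<bullet> e = 0" using g_inner[OF e(1)] e(2) by simp
          then show ?thesis using projector_sym[OF \<pi>(1)[OF p]] by (simp add: inner_commute)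
        qed
        then have "\<pi> p e = 0" by (metis inner_eq_zero_iff)
        ultimately have "e = 0" using transversal[OF p e(1)] by blast
        then have "w = y" using yz(3) e(2) linear_0[OF \<iota>D(1)] by simp
        then show "w \<in> g ` ?T" using y by simp
      qed
    qed
    then show "frechet_derivative g (at p within M) ` ?T = tangent_space (sphere 0 1) (g p)"
      using Dg by (metis image_cong)
  qed
  have hit: "\<exists>x\<in>M. g x = b" if b: "norm b = 1" for b
  proof -
    obtain e where e: "e \<in> ?E" "b = \<iota> e" using \<iota>D(3) by blast
    then show ?thesis using surj[OF e(1)] \<iota>D(2)[OF e(1)] b by (auto simp: g_def)
  qed
  show "eigenmap M lam (\<iota> \<circ> focal_map A s)"
    unfolding eigenmap_def g_def[symmetric]
  proof (intro conjI ballI)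
    obtain b :: "real^'l" where "b \<in> Basis" using nonempty_Basis by blast
    then have "M \<noteq> {}" using hit[of b] by auto
    then show "closed_submanifold M" using M by (auto simp: closed_submanifold_def)
    show "g ` M \<subseteq> sphere 0 1" by (rule gM)
    fix b :: "real^'l" assume b: "b \<in> Basis"
    \<comment> \<open>Components are restrictions of linear functions, so \<open>lap\<close> applies
      with \<open>adjoint g b\<close> as \<open>w\<close>.\<close>
    have eq: "(\<lambda>x. g x \<bullet> b) = (\<lambda>x. x \<bullet> adjoint g b)"
      by (simp add: adjoint_works[OF lin])
    have "\<exists>p\<in>M. g p \<bullet> b \<noteq> 0" using hit[of b] b by (metis inner_Basis norm_Basis zero_neq_one)
    moreover have "smooth_map M (\<lambda>x. g x \<bullet> b)"
      unfolding eq by (intro smooth_map_linear linearI) (auto simp: inner_add_left)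
    ultimately show "eigenfunction M lam (\<lambda>x. g x \<bullet> b)"
      unfolding eigenfunction_def using lap[of _ "adjoint g b"] by (simp add: eq fun_cong[OF eq])
  qed
qed

lemma ex_isometric_identification:
  assumes "trace_of (\<lambda>x. A *v x) = 0" "CARD('n) = 2 * CARD('l)"
  shows "\<exists>\<iota> :: real^'n \<Rightarrow> real^'l. isometric_identification (eigenspace A s) \<iota>"
proof -
  have "dim (eigenspace A s) = dim (UNIV :: (real^'l) set)"
    using dim_eigenspace[OF assms(1)] assms(2) by simp
  from isometries_subspaces[OF subspace_eigenspace subspace_UNIV this] obtain f :: "real^'n \<Rightarrow> real^'l"
    where "linear f" "f ` eigenspace A s = UNIV"
    "\<And>x. x \<in> eigenspace A s \<Longrightarrow> norm (f x) = norm x"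
    by metis
  then show ?thesis by (auto simp: isometric_identification_def)
qed

end

lemma trace_of_matrix: "trace_of (\<lambda>x. A *v x) = trace (A :: real^'n^'n)"
proof -
  have Basis: "Basis = range (\<lambda>i::'n. axis i (1::real))" by (auto simp: Basis_vec_def)
  have inj: "inj (\<lambda>i::'n. axis i (1::real))" by (simp add: inj_on_def axis_eq_axis)
  have "trace_of (\<lambda>x. A *v x) = (\<Sum>i\<in>UNIV. (A *v axis i 1) \<bullet> axis i 1)"
    unfolding trace_of_def Basis sum.reindex[OF inj] by simp
  then show ?thesis
    by (simp add: trace_def inner_axis matrix_vector_mult_basis column_def)
qed

section \<open>Symmetric Clifford systems of matrices\<close>

context
  fixes P :: "nat \<Rightarrow> real^'n^'n" and m :: nat
  assumes P: "symmetric_clifford_system m P" and m: "m > 0"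
begin

lemma clifford_sym: "a \<le> m \<Longrightarrow> (P a *v x) \<bullet> y = x \<bullet> (P a *v y)"
  using P unfolding symmetric_clifford_system_def
  by (metis dot_lmul_matrix transpose_matrix_vector)

lemma clifford_anticommute:
  assumes "a \<le> m" "b \<le> m"
  shows "P a *v (P b *v x) + P b *v (P a *v x) = (if a = b then 2 else 0) *\<^sub>R x"
proof -
  have "P a *v (P b *v x) + P b *v (P a *v x) = ((if a = b then 2 else 0) *\<^sub>R mat 1) *v x"
    using P assms unfolding symmetric_clifford_system_def
    by (metis matrix_vector_mul_assoc matrix_vector_mult_add_rdistrib)
  then show ?thesis by (simp add: scaleR_matrix_vector_assoc[symmetric])
qed

lemma clifford_invol: "a \<le> m \<Longrightarrow> P a *v (P a *v x) = x"
  using clifford_anticommute[of a a x] by (simp flip: scaleR_2)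

lemma clifford_swap: "a \<le> m \<Longrightarrow> b \<le> m \<Longrightarrow> a \<noteq> b \<Longrightarrow> P a *v (P b *v x) = - (P b *v (P a *v x))"
  using clifford_anticommute[of a b x] by (simp add: eq_neg_iff_add_eq_0)

text \<open>Conjugation by another member \<open>P b\<close>, which exists because
  \<open>m > 0\<close>, preserves the trace and turns \<open>P a\<close> into
  \<open>- P a\<close>.\<close>

lemma clifford_trace:
  assumes "a \<le> m"
  shows "trace_of (\<lambda>x. P a *v x) = 0"
proof -
  obtain b where b: "b \<le> m" "a \<noteq> b" using m by (metis le0 less_or_eq_imp_le not_gr0)
  have "trace (P a) = trace (P b ** (P a ** P b))"
    using trace_mul_sym[of "P b" "P a ** P b"] clifford_invol[OF b(1)]
    by (metis (no_types, lifting) matrix_eq matrix_mul_assoc matrix_vector_mul_assoc)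
  also have "\<dots> = trace_of (\<lambda>x. - (P a *v x))"
  proof -
    have "(P b ** (P a ** P b)) *v x = - (P a *v x)" for x
      by (simp add: matrix_vector_mul_assoc[symmetric] clifford_swap[OF assms b]
          clifford_invol[OF b(1)] linear_neg[OF matrix_vector_mul_linear])
    then show ?thesis unfolding trace_of_matrix[symmetric] trace_of_def by simp
  qed
  finally show ?thesis by (simp add: trace_of_matrix trace_of_minus)
qed

lemma clifford_family:
  assumes "J \<subseteq> {..m}"
  shows "clifford_family J (\<lambda>a x. P a *v x)"
proof (rule clifford_family.intro)
  show "finite J" using assms finite_subset by blast
  show "linear (\<lambda>x. P a *v x)" if "a \<in> J" for a by (rule matrix_vector_mul_linear)
  show "(P a *v x) \<bullet> y = x \<bullet> (P a *v y)" if "a \<in> J" for a x y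
    using that assms by (intro clifford_sym) auto
  show "P a *v (P b *v x) + P b *v (P a *v x) = (if a = b then 2 else 0) *\<^sub>R x"
    if "a \<in> J" "b \<in> J" for a b x
    using that assms by (intro clifford_anticommute) auto
  show "trace_of (\<lambda>x. P a *v x) = 0" if "a \<in> J" for a
    using that assms by (intro clifford_trace) auto
qed

text \<open>\<open>P b\<close> maps an eigenspace of \<open>P a\<close> into the opposite one, and
  the two are orthogonal.\<close>

lemma clifford_eigen_orthogonal:
  assumes "a \<le> m" "b \<le> m" "a \<noteq> b" "s \<in> {1, -1}" "P a *v x = s *\<^sub>R x"
  shows "(P b *v x) \<bullet> x = 0"
proof -
  have "s * ((P b *v x) \<bullet> x) = (P b *v x) \<bullet> (P a *v x)" by (simp add: assms(5))
  also have "\<dots> = (P a *v (P b *v x)) \<bullet> x" by (simp add: clifford_sym assms(1))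
  also have "\<dots> = - s * ((P b *v x) \<bullet> x)"
    by (simp add: clifford_swap[OF assms(1-3)] assms(5) matrix_vector_mult_scaleR)
  finally show ?thesis using assms(4) by auto
qed

text \<open>On an eigenspace of \<open>P (i + 1)\<close> the equations for the other operators hold
  automatically.\<close>

lemma clifford_U_eq:
  assumes "i + 1 \<le> m" "s \<in> {1, -1}"
  shows "clifford_U P i s = eigenspace (P (i + 1)) s \<inter> sphere 0 1"
proof -
  have "(P a *v x) \<bullet> x = 0" if "a \<le> i" "x \<in> eigenspace (P (i + 1)) s" for a x
    using clifford_eigen_orthogonal[of "i + 1" a s x] that assms by (auto simp: eigenspace_def)
  moreover note eigenspace_cap_sphere[OF assms(2) clifford_sym[OF assms(1)] clifford_invol[OF assms(1)]]
  ultimately show ?thesis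
    unfolding clifford_U_def clifford_M_def clifford_f_def by blast
qed

lemma clifford_V_eq:
  assumes "i \<le> m" "s \<in> {1, -1}"
  shows "clifford_V P i s = eigenspace (P i) s \<inter> sphere 0 1"
proof -
  have "(\<Sum>a\<le>i. ((P a *v x) \<bullet> x)\<^sup>2) = 1"
    if x: "x \<in> eigenspace (P i) s" "(P i *v x) \<bullet> x = s" for x
  proof -
    have "(\<Sum>a\<le>i. ((P a *v x) \<bullet> x)\<^sup>2) = (\<Sum>a\<le>i. if a = i then s\<^sup>2 else 0)"
      using clifford_eigen_orthogonal[of i _ s x] x assms
      by (intro sum.cong) (auto simp: eigenspace_def)
    then show ?thesis using assms(2) by auto
  qed
  with eigenspace_cap_sphere[OF assms(2) clifford_sym[OF assms(1)] clifford_invol[OF assms(1)]]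
  show ?thesis unfolding clifford_V_def clifford_N_def clifford_g_def by blast
qed

text \<open>A normal vector orthogonal to \<open>x\<close> is some \<open>comb c x\<close>. The
  eigenvector property gives \<open>c k = 0\<close>, so \<open>P k\<close> anticommutes with
  \<open>comb c\<close>, and \<open>e \<bullet> e\<close> becomes a multiple of
  \<open>x \<bullet> (P k *v x)\<close>, which is 0.\<close>

lemma clifford_M_transversal:
  assumes "k \<le> m" "s \<in> {1, -1}" "x \<in> clifford_M P k" "e \<in> eigenspace (P k) s"
    "x \<bullet> e = 0"
    and "clifford_family.proj_quadrics {..k} (\<lambda>a x. P a *v x) x e = 0"
  shows "e = 0"
proof -
  interpret clifford_family "{..k}" "\<lambda>a x. P a *v x" using clifford_family assms(1) by simp
  define c where "c a = (P a *v x) \<bullet> e" for a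
  have e: "P k *v e = s *\<^sub>R e" using assms(4) by (simp add: eigenspace_def)
  have xk: "(P k *v x) \<bullet> x = 0" using assms(3) by (simp add: clifford_M_def)
  have ec: "e = comb c x" using assms(5,6) by (simp add: proj_quadrics_def c_def[abs_def])
  have "c k = 0" using assms(1,5) e by (simp add: c_def clifford_sym)
  then have "P k *v comb c x = - comb c (P k *v x)"
    using P_comb_anticommute[of k c x] by (simp add: eq_neg_iff_add_eq_0)
  then have se: "s *\<^sub>R e = - comb c (P k *v x)" using e ec by simp
  have "s * (e \<bullet> e) = e \<bullet> (s *\<^sub>R e)" by simp
  also have "\<dots> = - (x \<bullet> comb c (comb c (P k *v x)))"
    unfolding se by (subst ec) (simp add: comb_sym)
  also have "\<dots> = 0" using xk by (simp add: comb_comb inner_commute)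
  finally show ?thesis using assms(2) by auto
qed

text \<open>The preimage is \<open>(e + y) / sqrt 2\<close> with a unit vector \<open>y\<close> in
  the opposite eigenspace orthogonal to all \<open>P a *v e\<close> for \<open>a < k\<close>. These
  are \<open>k\<close> vectors in a space of half the full dimension, so
  \<open>2 * k < CARD('n)\<close> guarantees such a \<open>y\<close>.\<close>

lemma clifford_M_surj:
  assumes "k \<le> m" "2 * k < CARD('n)" "s \<in> {1, -1}" "e \<in> eigenspace (P k) s" "norm e = 1"
  shows "\<exists>x\<in>clifford_M P k. focal_map (P k) s x = e"
proof -
  let ?B = "(\<lambda>a. P a *v e) ` {..<k}" and ?F = "eigenspace (P k) (- s)"
  have s': "- s \<in> {1, -1}" using assms(3) by auto
  note k = clifford_sym[OF assms(1)] clifford_invol[OF assms(1)]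
  have e: "P k *v e = s *\<^sub>R e" using assms(4) by (simp add: eigenspace_def)
  have sub: "subspace ?F" by (rule subspace_eigenspace[OF s' k])
  have "?B \<subseteq> ?F"
    using clifford_swap[OF assms(1)] assms(1) e
    by (auto simp: eigenspace_def matrix_vector_mult_scaleR)
  then have "span ?B \<subseteq> ?F" using sub by (rule span_minimal)
  moreover have "dim ?B < dim ?F"
  proof -
    have "dim ?B \<le> k" using dim_le_card[of ?B ?B] card_image_le[of "{..<k}" "\<lambda>a. P a *v e"]
      by (simp add: span_superset)
    then show ?thesis
      using dim_eigenspace[OF s' k clifford_trace[OF assms(1)]] assms(2) by linarith
  qed
  ultimately have "span ?B \<subset> span ?F" using sub by (metis dim_span less_irrefl psubsetI span_eq_iff)
  from orthogonal_to_subspace_exists_gen[OF this] obtain z where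
    z: "z \<noteq> 0" "z \<in> ?F" "\<And>v. v \<in> span ?B \<Longrightarrow> orthogonal z v"
    using sub by (metis span_eq_iff)
  define y where "y = sgn z"
  have y: "P k *v y = (- s) *\<^sub>R y" "y \<bullet> y = 1"
    "\<And>a. a < k \<Longrightarrow> (P a *v e) \<bullet> y = 0"
  proof -
    show "P k *v y = (- s) *\<^sub>R y"
      using z(2) by (simp add: y_def sgn_div_norm eigenspace_def matrix_vector_mult_scaleR)
    show "y \<bullet> y = 1" using z(1) by (simp add: y_def norm_sgn flip: norm_eq_1)
    show "(P a *v e) \<bullet> y = 0" if "a < k" for a
      using z(3)[OF span_base, of "P a *v e"] that
      by (auto simp: y_def sgn_div_norm orthogonal_def inner_commute)
  qed
  have "s * (e \<bullet> y) = - s * (e \<bullet> y)"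
    using k(1)[of e y] e y(1) by simp
  then have ey: "e \<bullet> y = 0" using assms(3) by auto
  have ee: "e \<bullet> e = 1" using assms(5) by (simp add: norm_eq_1)
  define x where "x = (1 / sqrt 2) *\<^sub>R (e + y)"
  have "x \<bullet> x = 1" using ee y(2) ey by (simp add: x_def inner_add_left inner_add_right inner_commute)
  moreover have "(P a *v x) \<bullet> x = 0" if "a \<le> k" for a
  proof -
    \<comment> \<open>For \<open>a = k\<close> the contributions \<open>s\<close> and
      \<open>- s\<close> cancel. Otherwise \<open>P a\<close> exchanges the eigenspaces, which
      removes the diagonal terms, and the mixed ones vanish by the choice of
      \<open>y\<close>.\<close>
    have "(P a *v (e + y)) \<bullet> (e + y) = 0"
    proof (cases "a = k")
      case True
      then show ?thesis
        using e y ee ey by (simp add: matrix_vector_right_distrib inner_add_left inner_add_right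
            inner_diff_left inner_diff_right inner_commute)
    next
      case False
      then have "(P a *v e) \<bullet> e = 0" "(P a *v y) \<bullet> y = 0" "(P a *v e) \<bullet> y = 0"
    "(P a *v y) \<bullet> e = 0"
        using clifford_eigen_orthogonal[OF assms(1) _ _ assms(3) e, of a]
          clifford_eigen_orthogonal[OF assms(1) _ _ s' y(1), of a] y(3)[of a] that assms(1)
          clifford_sym[of a y e] by (auto simp: inner_commute)
      then show ?thesis by (simp add: matrix_vector_right_distrib inner_add_left inner_add_right)
    qed
    then show ?thesis by (simp add: x_def matrix_vector_mult_scaleR)
  qed
  ultimately have "x \<in> clifford_M P k" by (simp add: clifford_M_def norm_eq_1)
  then show ?thesis using focal_map_of_eigen_sum[OF assms(3) e y(1)] x_def by blast
qed

lemma clifford_M_eq: "clifford_M P k = clifford_family.quadrics {..k} (\<lambda>a x. P a *v x)" if "k \<le> m"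
  using clifford_family[of "{..k}"] that
  by (auto simp: clifford_M_def clifford_family.quadrics_def)

lemma clifford_N_eq: "clifford_N P k = clifford_family.focal {..k} (\<lambda>a x. P a *v x)" if "k \<le> m"
  using clifford_family[of "{..k}"] that
  by (simp add: clifford_N_def clifford_family.focal_def clifford_family.qform_def)

text \<open>All three parts rest on \<open>P i\<close> anticommuting with every \<open>comb\<close>
  over \<open>{..k}\<close>. Hence \<open>P i *v x\<close> lies in the -1-eigenspace of
  \<open>comb (qform x)\<close>, orthogonal to \<open>x\<close>. A normal vector \<open>e\<close>
  orthogonal to \<open>x\<close> lies in that -1-eigenspace as well, and a nonzero one cannot also
  be an eigenvector of \<open>P i\<close>.\<close>

lemma
  assumes "k < i" "i \<le> m" "s \<in> {1, -1}"
  shows clifford_N_orthogonal: "x \<in> clifford_N P k \<Longrightarrow> (P i *v x) \<bullet> x = 0"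
    and clifford_N_transversal: "x \<in> clifford_N P k \<Longrightarrow> e \<in> eigenspace (P i) s \<Longrightarrow> x \<bullet> e = 0 \<Longrightarrow>
      clifford_family.proj_focal {..k} (\<lambda>a x. P a *v x) x e = 0 \<Longrightarrow> e = 0"
    and clifford_N_surj: "e \<in> eigenspace (P i) s \<Longrightarrow> norm e = 1 \<Longrightarrow> \<exists>x\<in>clifford_N P k. focal_map (P i) s x = e"
proof -
  interpret clifford_family "{..k}" "\<lambda>a x. P a *v x" using clifford_family assms by simp
  have N: "clifford_N P k = focal" using clifford_N_eq assms by simp
  have swap: "P i *v comb c y = - comb c (P i *v y)" for c y
  proof -
    have "P i *v comb c y = (\<Sum>a\<le>k. c a *\<^sub>R (P i *v (P a *v y)))"
      by (simp add: comb_def linear_sum[OF matrix_vector_mul_linear] matrix_vector_mult_scaleR)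
    also have "\<dots> = (\<Sum>a\<le>k. - (c a *\<^sub>R (P a *v (P i *v y))))"
      using assms by (intro sum.cong) (auto simp: clifford_swap[of i])
    finally show ?thesis by (simp add: comb_def sum_negf)
  qed
  show "(P i *v x) \<bullet> x = 0" if "x \<in> clifford_N P k"
  proof -
    have x: "comb (qform x) x = x" using that N focal_iff by simp
    have "P i *v x = - comb (qform x) (P i *v x)"
      using swap[of "qform x" x] x by simp
    then have "(P i *v x) \<bullet> x = (- comb (qform x) (P i *v x)) \<bullet> x" by (rule arg_cong)
    then have "(P i *v x) \<bullet> x = - (comb (qform x) (P i *v x) \<bullet> x)"
      by (simp only: inner_minus_left)
    then show ?thesis using comb_sym[of "qform x" "P i *v x" x] x by simp
  qed
  show "e = 0" if x: "x \<in> clifford_N P k" and e: "e \<in> eigenspace (P i) s" "x \<bullet> e = 0"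
    "proj_focal x e = 0"
  proof -
    have x': "x \<in> focal" using x N by simp
    have K0: "radial_proj x e = 0" using e(2) by (simp add: radial_proj_def[OF x'])
    then have "eigen_proj x e + frame_proj x e = 0" using e(3) by (simp add: proj_focal_eq[OF x'])
    \<comment> \<open>\<open>eigen_proj\<close> turns the frame part into the radial part, which is
      0.\<close>
    then have "eigen_proj x (eigen_proj x e + frame_proj x e) = 0" using linear_0[OF linear_eigen_proj[OF x']] by simp
    then have "eigen_proj x e = 0"
      by (simp add: linear_add[OF linear_eigen_proj[OF x']] projs_compose[OF x'] K0)
    then have Qe: "comb (qform x) e = - e" by (simp add: eigen_proj_def[OF x'] add_eq_0_iff)
    have ei: "P i *v e = s *\<^sub>R e" using e(1) by (simp add: eigenspace_def)
    have "s *\<^sub>R e = - s *\<^sub>R e"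
      using swap[of "qform x" e] Qe ei linear_neg[OF matrix_vector_mul_linear, of "P i" e]
      by (simp add: linear_scale[OF linear_comb])
    then have "s = - s \<or> e = 0" by (simp only: scaleR_cancel_right)
    then show ?thesis using assms(3) by auto
  qed
  show "\<exists>x\<in>clifford_N P k. focal_map (P i) s x = e" if e: "e \<in> eigenspace (P i) s"
    "norm e = 1"
  proof -
    \<comment> \<open>\<open>P 0 *v e\<close> lies in the opposite eigenspace of \<open>P i\<close>,
      and the sum is fixed by \<open>P 0\<close>; so the unit coefficient vector concentrated at 0
      witnesses membership in \<open>focal\<close>.\<close>
    define x where "x = (1 / sqrt 2) *\<^sub>R (e + P 0 *v e)"
    have ei: "P i *v e = s *\<^sub>R e" using e(1) by (simp add: eigenspace_def)
    have y: "P i *v (P 0 *v e) = (- s) *\<^sub>R (P 0 *v e)"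
      using clifford_swap[of i 0 e] assms ei by (simp add: matrix_vector_mult_scaleR)
    have "(P 0 *v e) \<bullet> e = 0"
      using clifford_eigen_orthogonal[OF assms(2) _ _ assms(3) ei, of 0] assms by simp
    moreover have "(P 0 *v e) \<bullet> (P 0 *v e) = 1"
      using e(2) P_inner_P[of 0 0 e] by (simp add: norm_eq_1)
    ultimately have "x \<bullet> x = 1"
      using e(2) by (simp add: x_def inner_add_left inner_add_right inner_commute norm_eq_1)
    then have nx: "norm x = 1" by (simp add: norm_eq_1)
    have P0: "P 0 *v x = x"
      by (simp add: x_def matrix_vector_mult_scaleR matrix_vector_right_distrib clifford_invol add.commute)
    let ?r = "\<lambda>a::nat. if a = 0 then 1 else 0 :: real"
    have "comb ?r x = (\<Sum>a\<le>k. if a = 0 then x else 0)"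
      unfolding comb_def using P0 by (intro sum.cong) auto
    moreover have "(\<Sum>a\<le>k. (?r a)\<^sup>2) = (\<Sum>a\<le>k. if a = 0 then 1 else 0)"
      by (intro sum.cong) auto
    ultimately have "sgn x \<in> focal"
      using nx by (intro sgn_in_focal[of x ?r]) auto
    then have "x \<in> clifford_N P k" using nx N by (simp add: sgn_div_norm)
    then show ?thesis using focal_map_of_eigen_sum[OF assms(3) ei y] x_def by blast
  qed
qed

end

theorem theorem1p4:
  fixes P :: "nat \<Rightarrow> real^'n^'n" and m l :: nat
  assumes "CARD('l::finite) = l" and "CARD('n) = 2 * l"
    and "symmetric_clifford_system m P"
    and "m > 0" and "int l - int m - 1 > 0"
  shows "(\<forall>i. i + 1 \<le> m \<longrightarrow> (\<forall>s\<in>{1, -1}.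
      focal_map (P (i + 1)) s ` clifford_M P (i + 1) \<subseteq> clifford_U P i s \<and>
      (\<exists>\<iota> :: real^'n \<Rightarrow> real^'l. isometric_identification (eigenspace (P (i + 1)) s) \<iota>) \<and>
      (\<forall>\<iota> :: real^'n \<Rightarrow> real^'l. isometric_identification (eigenspace (P (i + 1)) s) \<iota> \<longrightarrow>
         bij_betw \<iota> (clifford_U P i s) (sphere 0 1) \<and>
         smooth_submersion (clifford_M P (i + 1)) (sphere 0 1) (\<iota> \<circ> focal_map (P (i + 1)) s) \<and>
         eigenmap (clifford_M P (i + 1)) (2 * real l - real i - 3)
           (\<iota> \<circ> focal_map (P (i + 1)) s)))) \<and>
    (\<forall>i. 2 \<le> i \<and> i \<le> m \<longrightarrow> (\<forall>s\<in>{1, -1}.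
      focal_map (P i) s ` clifford_N P (i - 1) \<subseteq> clifford_V P i s \<and>
      (\<exists>\<iota> :: real^'n \<Rightarrow> real^'l. isometric_identification (eigenspace (P i) s) \<iota>) \<and>
      (\<forall>\<iota> :: real^'n \<Rightarrow> real^'l. isometric_identification (eigenspace (P i) s) \<iota> \<longrightarrow>
         bij_betw \<iota> (clifford_V P i s) (sphere 0 1) \<and>
         smooth_submersion (clifford_N P (i - 1)) (sphere 0 1) (\<iota> \<circ> focal_map (P i) s) \<and>
         eigenmap (clifford_N P (i - 1)) (real l + real i - 2)
           (\<iota> \<circ> focal_map (P i) s))))"
proof (intro conjI allI impI ballI)
  note cs = assms(3,4)
  have card: "CARD('n) = 2 * CARD('l)" using assms(1,2) by simp
  have lm: "m + 1 < l" using assms(5) by linarith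
  {
    fix i and s :: real assume i: "i + 1 \<le> m" and s: "s \<in> {1, -1}"
    interpret clifford_family "{..i + 1}" "\<lambda>a x. P a *v x" using clifford_family[OF cs] i by simp
    note A = s clifford_sym[OF cs i] clifford_invol[OF cs i]
    have M: "clifford_M P (i + 1) = quadrics" by (rule clifford_M_eq[OF cs i])
    have U: "clifford_U P i s = eigenspace (P (i + 1)) s \<inter> sphere 0 1"
      by (rule clifford_U_eq[OF cs i s])
    have A0: "(P (i + 1) *v x) \<bullet> x = 0" if "x \<in> quadrics" for x
      using quadricsD(3)[OF that, of "i + 1"] by simp
    show "focal_map (P (i + 1)) s ` clifford_M P (i + 1) \<subseteq> clifford_U P i s"
      unfolding U M using focal_map_in_eigenspace[OF A] norm_focal_map[OF A quadricsD(2) A0] by auto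
    show "\<exists>\<iota> :: real^'n \<Rightarrow> real^'l. isometric_identification (eigenspace (P (i + 1)) s) \<iota>"
      by (rule ex_isometric_identification[OF A clifford_trace[OF cs i] card])
    fix \<iota> :: "real^'n \<Rightarrow> real^'l" assume \<iota>: "isometric_identification (eigenspace (P (i + 1)) s) \<iota>"
    show "bij_betw \<iota> (clifford_U P i s) (sphere 0 1)"
      unfolding U by (rule isometric_identification_bij_betw[OF \<iota> subspace_eigenspace[OF A]])
    \<comment> \<open>The index set \<open>{..i + 1}\<close> has \<open>i + 2\<close> elements; the
      natural-number subtraction is exact because \<open>m + 1 < l\<close>.\<close>
    have "smooth_submanifold (2 * l - i - 3) quadrics"
      using assms(2) lm i by (intro smooth_submanifold_quadrics) simp
    moreover have "laplacian quadrics (\<lambda>x. x \<bullet> w) x = - (2 * real l - real i - 3) * (x \<bullet> w)"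
      if "x \<in> quadrics" for x w
      using laplacian_quadrics[OF that, of w] assms(2) by (simp add: algebra_simps)
    moreover have "quadrics \<subseteq> sphere 0 1" unfolding quadrics_def by blast
    ultimately have "smooth_submersion quadrics (sphere 0 1) (\<iota> \<circ> focal_map (P (i + 1)) s) \<and>
        eigenmap quadrics (2 * real l - real i - 3) (\<iota> \<circ> focal_map (P (i + 1)) s)"
      using clifford_M_transversal[OF cs i s, unfolded M] clifford_M_surj[OF cs i _ s, unfolded M]
        assms(2) lm i
      by (intro focal_map_submersive_eigenmap[OF A compact_quadrics _ _ orthogonal_projector_quadrics
            tangent_space_quadrics _ A0 _ _ \<iota>]) auto
    then show "smooth_submersion (clifford_M P (i + 1)) (sphere 0 1) (\<iota> \<circ> focal_map (P (i + 1)) s)"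
      "eigenmap (clifford_M P (i + 1)) (2 * real l - real i - 3) (\<iota> \<circ> focal_map (P (i + 1)) s)"
      unfolding M by auto
  }
  fix i and s :: real assume i': "2 \<le> i \<and> i \<le> m" and s: "s \<in> {1, -1}"
  have i: "i \<le> m" "i - 1 < i" "i - 1 \<le> m" using i' by auto
  interpret clifford_family "{..i - 1}" "\<lambda>a x. P a *v x" using clifford_family[OF cs] i by simp
  note A = s clifford_sym[OF cs i(1)] clifford_invol[OF cs i(1)]
  have N: "clifford_N P (i - 1) = focal" by (rule clifford_N_eq[OF cs i(3)])
  have V: "clifford_V P i s = eigenspace (P i) s \<inter> sphere 0 1"
    by (rule clifford_V_eq[OF cs i(1) s])
  note orthogonal = clifford_N_orthogonal[OF cs i(2,1) s, unfolded N]
  show "focal_map (P i) s ` clifford_N P (i - 1) \<subseteq> clifford_V P i s"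
    unfolding V N using focal_map_in_eigenspace[OF A] norm_focal_map[OF A focal_unit(2) orthogonal] by auto
  show "\<exists>\<iota> :: real^'n \<Rightarrow> real^'l. isometric_identification (eigenspace (P i) s) \<iota>"
    by (rule ex_isometric_identification[OF A clifford_trace[OF cs i(1)] card])
  fix \<iota> :: "real^'n \<Rightarrow> real^'l" assume \<iota>: "isometric_identification (eigenspace (P i) s) \<iota>"
  show "bij_betw \<iota> (clifford_V P i s) (sphere 0 1)"
    unfolding V by (rule isometric_identification_bij_betw[OF \<iota> subspace_eigenspace[OF A]])
  \<comment> \<open>The index set \<open>{..i - 1}\<close> has \<open>i\<close> elements, as
    \<open>i\<close> is at least 2.\<close>
  have "2 * (l + i - 2) + 4 = CARD('n) + 2 * i" using assms(2) i' by linarith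
  then have "smooth_submanifold (l + i - 2) focal"
    using i' by (intro smooth_submanifold_focal) simp
  moreover have "laplacian focal (\<lambda>x. x \<bullet> w) x = - (real l + real i - 2) * (x \<bullet> w)"
    if "x \<in> focal" for x w
    using laplacian_focal[OF that, of w] assms(2) i' by simp
  moreover have "focal \<subseteq> sphere 0 1" unfolding focal_def by blast
  ultimately have "smooth_submersion focal (sphere 0 1) (\<iota> \<circ> focal_map (P i) s) \<and>
      eigenmap focal (real l + real i - 2) (\<iota> \<circ> focal_map (P i) s)"
    using clifford_N_transversal[OF cs i(2,1) s, unfolded N] clifford_N_surj[OF cs i(2,1) s, unfolded N]
    by (intro focal_map_submersive_eigenmap[OF A compact_focal _ _ orthogonal_projector_focal
          tangent_space_focal _ orthogonal _ _ \<iota>]) auto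
  then show "smooth_submersion (clifford_N P (i - 1)) (sphere 0 1) (\<iota> \<circ> focal_map (P i) s)"
    "eigenmap (clifford_N P (i - 1)) (real l + real i - 2) (\<iota> \<circ> focal_map (P i) s)"
    unfolding N by auto
qed

end
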